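(* Let $r\in\{0,1,2,\dots\}$ be fixed and let $n\to\infty$. Then the expectation and variance of the size $X_{n,r}$ of the $r$-fold leaf-cut random plane tree satisfy $$\mathbb{E} X_{n,r} = \frac{n}{r+1} - \frac{r(r-1)}{6(r+1)} + O(n^{-1}),\qquad \mathbb{V} X_{n,r} = \frac{r(r+2)}{6(r+1)^2}\,n + O(1).$$ Moreover, for every fixed integer $d\ge 1$ the $d$th factorial moment satisfies $$\mathbb{E} X_{n,r}^{\underline{d}} = \frac{1}{(r+1)^d}n^d + \frac{d}{12(r+1)^d}\bigl(dr^2-4dr-3r^2-6d+6r+6\bigr)n^{d-1} + O(n^{d-3/2}).$$ All $O$-constants may depend on $r$ (and on $d$).
   Context: A plane tree is a finite rooted tree in which the children of every node are linearly ordered; its size is its number of nodes. There are $C_{n-1}=\frac1n\binom{2n-2}{n-1}$ plane trees of size $n\ge1$. A leaf is a node without children (the single-node tree consists of one leaf). For a plane tree $\tau$ with at least two nodes, $\rho(\tau)$ is the plane tree obtained by simultaneously deleting all leaves of $\tau$; $\rho$ is not defined on the single-node tree. $X_{n,r}$ is the random variable equal to the size of $\rho^r(\tau)$, where $\tau$ is chosen uniformly at random among all plane trees of size $n$; if $\rho^r(\tau)$ is not defined, then $X_{n,r}=0$. In particular $X_{n,0}=n$. Falling factorial: $x^{\underline d}=x(x-1)\cdots(x-d+1)$. *)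

theory Defs
  imports "HOL-Probability.Probability" "HOL-Library.Landau_Symbols"
begin

datatype plane_tree = PNode (children: "plane_tree list")

(* The number of nodes.  The generated function size also counts list cells, so it is not used. *)
primrec tree_size :: "plane_tree \<Rightarrow> nat" where
  "tree_size (PNode ts) = Suc (sum_list (map tree_size ts))"

definition is_leaf :: "plane_tree \<Rightarrow> bool" where
  "is_leaf t \<longleftrightarrow> children t = []"

(* Deletes all leaves other than the root.  A node whose children are all leaves
   becomes a leaf of the result and is kept: only the leaves of the original tree are deleted. *)
fun delete_leaves :: "plane_tree \<Rightarrow> plane_tree" where
  "delete_leaves (PNode ts) = PNode (map delete_leaves (filter (\<lambda>t. \<not> is_leaf t) ts))"

definition rho :: "plane_tree \<Rightarrow> plane_tree option" where
  "rho t = (if is_leaf t then None else Some (delete_leaves t))"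

primrec rho_iter :: "nat \<Rightarrow> plane_tree \<Rightarrow> plane_tree option" where
  "rho_iter 0 t = Some t"
| "rho_iter (Suc r) t = Option.bind (rho_iter r t) rho"

definition cut_size :: "nat \<Rightarrow> plane_tree \<Rightarrow> nat" where
  "cut_size r t = (case rho_iter r t of None \<Rightarrow> 0 | Some t' \<Rightarrow> tree_size t')"

definition plane_trees :: "nat \<Rightarrow> plane_tree set" where
  "plane_trees n = {t. tree_size t = n}"

lemma tree_size_pos: "tree_size t > 0"
  by (cases t) simp

lemma finite_plane_trees: "finite (plane_trees n)"
proof (induction n rule: less_induct)
  case (less n)
  define F where "F = (\<Union>m<n. plane_trees m)"
  have "finite F"
    using less by (simp add: F_def)
  have "plane_trees n \<subseteq> PNode ` {ts. set ts \<subseteq> F \<and> length ts \<le> n}"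
  proof
    fix t assume "t \<in> plane_trees n"
    then obtain ts where t: "t = PNode ts" and n: "n = Suc (sum_list (map tree_size ts))"
      by (cases t) (auto simp: plane_trees_def)
    have "set ts \<subseteq> F"
      using member_le_sum_list[of _ "map tree_size ts"]
      by (fastforce simp: F_def plane_trees_def n less_Suc_eq_le)
    moreover have "length ts \<le> sum_list (map tree_size ts)" for ts :: "plane_tree list"
    proof (induction ts)
      case (Cons s ts)
      then show ?case
        using tree_size_pos[of s] by simp
    qed simp
    then have "length ts \<le> n"
      by (simp add: n le_SucI)
    ultimately show "t \<in> PNode ` {ts. set ts \<subseteq> F \<and> length ts \<le> n}"
      by (auto simp: t)
  qed
  then show ?case
    using finite_lists_length_le[OF \<open>finite F\<close>] by (meson finite_imageI finite_subset)
qed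

lemma plane_trees_nonempty: "n \<ge> 1 \<Longrightarrow> plane_trees n \<noteq> {}"
proof -
  assume "n \<ge> 1"
  then have "PNode (replicate (n - 1) (PNode [])) \<in> plane_trees n"
    by (simp add: plane_trees_def sum_list_replicate)
  then show ?thesis by blast
qed

(* The uniform distribution on plane trees with n nodes.  It is meaningful for n at least 1
   (see the two preceding lemmas) and unspecified for n = 0, where there are no trees. *)
definition random_plane_tree :: "nat \<Rightarrow> plane_tree pmf" where
  "random_plane_tree n = pmf_of_set (plane_trees n)"

definition falling_factorial :: "real \<Rightarrow> nat \<Rightarrow> real" where
  "falling_factorial x d = (\<Prod>i<d. x - real i)"

end

theory Submission
  imports Defs
begin

text \<open>
  A node survives \<open>r\<close> rounds of leaf cutting exactly if the subtree hanging from it has height at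
  least \<open>r\<close>, so the cut size is a node count that is additive over subtrees
  (\<open>cut_size_eq_tall_nodes\<close>). Let \<open>H\<close> be the generating function of all plane trees in which \<open>z\<close> marks
  nodes and \<open>v = 1 + w\<close> marks nodes of height at least \<open>r\<close>, and let \<open>B\<close> be the generating function of
  the trees of height less than \<open>r\<close>. Removing the root gives the quadratic equation
  \<open>H = (1 - v) B + v z / (1 - H)\<close>, and \<open>S = 1 - w B - 2 H\<close> is the square root of its discriminant
  \<open>(1 - 4 z) + 2 w (B - 2 z) + w\<^sup>2 B\<^sup>2\<close> (\<open>disc_root_square\<close>).

  The expansion of \<open>S\<close> in powers of \<open>w\<close> produces the factorial moments: with \<open>Y = 1 - 4 z\<close>, the
  coefficient of \<open>w\<^sup>d\<close> is \<open>Y\<close> to the power \<open>1/2 - d\<close> times a series \<open>P d\<close> which is a polynomial in \<open>z\<close>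
  and \<open>B\<close>. The trees of bounded height are exponentially rarer than all trees, so \<open>B\<close>, and with it
  \<open>P d\<close>, converges beyond the dominant singularity \<open>z = 1/4\<close>. Hence only the values of \<open>P d\<close> and of
  its derivative at \<open>1/4\<close> matter for two terms of the asymptotics. Modulo products of \<open>Y\<^sup>2\<close> with series
  of radius greater than \<open>1/4\<close>, they are computed first for \<open>B\<close>, by the recursion \<open>C (1 - B) = z\<close> in which
  \<open>C\<close> belongs to height \<open>r + 1\<close> (\<open>low_expansion\<close>), and then for all \<open>P d\<close> together, from the square of
  the series with coefficients \<open>P d\<close> (\<open>lead_approximates\<close>).

  No complex analysis is needed to read off coefficients. The ratio of the \<open>n\<close>-th coefficients of
  \<open>Y\<close> to the powers \<open>1/2 - d\<close> and \<open>1/2\<close> is exactly a Pochhammer symbol in \<open>n\<close> (\<open>Ypow_ratio\<close>), while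
  the coefficient of \<open>Y\<close> to the power \<open>1/2\<close> counts all trees up to the factor \<open>-1/2\<close>; and multiplying
  by a series of radius greater than \<open>1/4\<close> does not change the order of growth
  (\<open>mult_radius_gt_quarter_bigo\<close>). The error in the \<open>d\<close>-th factorial moment obtained in this way is of order
  \<open>n\<close> to the power \<open>d - 2\<close> (\<open>factorial_moment_asymptotics\<close>), which gives all three claims: the mean
  is the case \<open>d = 1\<close>, and the variance combines \<open>d = 1\<close> and \<open>d = 2\<close>, where the quadratic terms
  cancel.
\<close>

unbundle no vec_syntax
unbundle fps_syntax

section \<open>Cut sizes as counts of nodes of large height\<close>

text \<open>
  The height of the tree is at least \<open>r\<close>, where a single node has height 0.
\<close>

primrec tall :: "nat \<Rightarrow> plane_tree \<Rightarrow> bool" where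
  "tall 0 t \<longleftrightarrow> True"
| "tall (Suc r) t \<longleftrightarrow> (\<exists>s\<in>set (children t). tall r s)"

primrec tall_nodes :: "nat \<Rightarrow> plane_tree \<Rightarrow> nat" where
  "tall_nodes r (PNode ts) = sum_list (map (tall_nodes r) ts) + of_bool (tall r (PNode ts))"

lemma children_delete_leaves:
  "children (delete_leaves t) = map delete_leaves (filter (\<lambda>s. \<not> is_leaf s) (children t))"
  by (cases t) simp

lemma not_tall_leaf: "is_leaf t \<Longrightarrow> \<not> tall (Suc r) t"
  by (simp add: is_leaf_def)

text \<open>
  Cutting the leaves lowers every height by one, except that a leaf at the root is kept; hence the
  restriction to trees with more than one node.
\<close>

lemma tall_delete_leaves: "\<not> is_leaf t \<Longrightarrow> tall r (delete_leaves t) \<longleftrightarrow> tall (Suc r) t"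
proof (induction r arbitrary: t)
  case 0
  then show ?case
    by (auto simp: is_leaf_def neq_Nil_conv)
next
  case (Suc r)
  have "tall (Suc r) (delete_leaves t) \<longleftrightarrow>
        (\<exists>s\<in>set (children t). \<not> is_leaf s \<and> tall (Suc r) s)"
    using Suc.IH by (auto simp: children_delete_leaves simp del: tall.simps(2) simp: tall.simps(2)[of r "delete_leaves t"])
  also have "\<dots> \<longleftrightarrow> tall (Suc (Suc r)) t"
    using not_tall_leaf by (auto simp del: tall.simps(2) simp: tall.simps(2)[of "Suc r" t])
  finally show ?case .
qed

lemma tall_nodes_leaf: "is_leaf t \<Longrightarrow> tall_nodes (Suc r) t = 0"
  by (cases t) (auto simp: is_leaf_def)

text \<open>
  The nodes of height at least \<open>r\<close> after a cut correspond to those of height at least \<open>r + 1\<close> before it: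
  the deleted leaves are not counted on either side.
\<close>

lemma tall_nodes_delete_leaves:
  "\<not> is_leaf t \<Longrightarrow> tall_nodes r (delete_leaves t) = tall_nodes (Suc r) t"
proof (induction t)
  case (PNode ts)
  have "sum_list (map (tall_nodes r) (map delete_leaves (filter (\<lambda>s. \<not> is_leaf s) ts)))
      = sum_list (map (tall_nodes (Suc r)) ts)"
    using PNode.IH
  proof (induction ts)
    case (Cons s ts)
    then show ?case
      by (cases "is_leaf s") (simp_all add: tall_nodes_leaf)
  qed simp
  then show ?case
    using tall_delete_leaves[OF PNode.prems, of r] by (simp del: tall.simps)
qed

lemma tall_nodes_0: "tall_nodes 0 t = tree_size t"
proof (induction t)
  case (PNode ts)
  then have "map (tall_nodes 0) ts = map tree_size ts"
    by simp
  then show ?case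
    by (simp only: tall_nodes.simps tree_size.simps) simp
qed

text \<open>
  The iteration applies its last cut outermost, whereas comparing heights before and after a cut
  requires the first cut to be split off.
\<close>

lemma rho_iter_Suc_shift: "rho_iter (Suc r) t = Option.bind (rho t) (rho_iter r)"
proof (induction r)
  case 0
  then show ?case by (cases "rho t") simp_all
next
  case (Suc r)
  have "rho_iter (Suc (Suc r)) t = Option.bind (Option.bind (rho t) (rho_iter r)) rho"
    by (simp only: rho_iter.simps(2)[of "Suc r"] Suc)
  then show ?case
    by (cases "rho t") simp_all
qed

lemma cut_size_eq_tall_nodes: "cut_size r t = tall_nodes r t"
proof (induction r arbitrary: t)
  case 0
  then show ?case by (simp add: cut_size_def tall_nodes_0)
next
  case (Suc r)
  show ?case
  proof (cases "is_leaf t")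
    case True
    then show ?thesis
      unfolding cut_size_def rho_iter_Suc_shift by (simp add: rho_def tall_nodes_leaf)
  next
    case False
    then have "cut_size (Suc r) t = cut_size r (delete_leaves t)"
      unfolding cut_size_def rho_iter_Suc_shift by (simp add: rho_def)
    then show ?thesis
      using False by (simp add: Suc tall_nodes_delete_leaves)
  qed
qed

section \<open>Generating functions of trees and forests\<close>

text \<open>
  Removing the root from a tree with \<open>n + 1\<close> nodes leaves a list of trees with \<open>n\<close> nodes in total.
\<close>

definition plane_forests :: "nat \<Rightarrow> plane_tree list set" where
  "plane_forests n = {ts. sum_list (map tree_size ts) = n}"

text \<open>
  The weights may lie in any commutative ring, so that the same equations serve for counting trees with a
  property (weights 0 and 1) and for marking nodes (weights that are powers of a second variable).
\<close>

definition tree_gf :: "(plane_tree \<Rightarrow> 'a) \<Rightarrow> 'a::comm_ring_1 fps" where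
  "tree_gf f = Abs_fps (\<lambda>n. \<Sum>t\<in>plane_trees n. f t)"

definition forest_gf :: "(plane_tree \<Rightarrow> 'a) \<Rightarrow> 'a::comm_ring_1 fps" where
  "forest_gf f = Abs_fps (\<lambda>n. \<Sum>ts\<in>plane_forests n. prod_list (map f ts))"

lemma plane_trees_0: "plane_trees 0 = {}"
  using tree_size_pos by (auto simp: plane_trees_def)

lemma plane_trees_Suc: "plane_trees (Suc n) = PNode ` plane_forests n"
proof -
  have "t \<in> PNode ` plane_forests n" if "tree_size t = Suc n" for t
    using that by (cases t) (auto simp: plane_forests_def)
  then show ?thesis
    by (auto simp: plane_trees_def plane_forests_def)
qed

lemma finite_plane_forests: "finite (plane_forests n)"
  using finite_plane_trees[of "Suc n"] unfolding plane_trees_Suc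
  by (rule finite_imageD) (simp add: inj_on_def)

lemma sum_plane_trees_Suc: "(\<Sum>t\<in>plane_trees (Suc n). g t) = (\<Sum>ts\<in>plane_forests n. g (PNode ts))"
  unfolding plane_trees_Suc by (subst sum.reindex) (simp_all add: inj_on_def)

lemma plane_forests_decomp:
  "plane_forests n = (if n = 0 then {[]} else {}) \<union>
     (\<lambda>(t, ts). t # ts) ` (\<Union>i\<in>{..n}. plane_trees i \<times> plane_forests (n - i))" (is "?L = ?R")
proof (intro equalityI subsetI)
  fix ts assume "ts \<in> ?L"
  then show "ts \<in> ?R"
    by (cases ts) (auto simp: plane_forests_def plane_trees_def image_iff)
next
  fix ts assume "ts \<in> ?R"
  then show "ts \<in> ?L"
    by (auto simp: plane_forests_def plane_trees_def split: if_splits)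
qed

text \<open>
  A nonempty forest is a first tree followed by a forest, and multiplicative weights split
  accordingly.
\<close>

lemma forest_gf_eq: "forest_gf f = 1 + tree_gf f * forest_gf f"
proof (rule fps_ext)
  fix n
  let ?U = "\<Union>i\<in>{..n}. plane_trees i \<times> plane_forests (n - i)"
  let ?w = "\<lambda>ts. prod_list (map f ts)"
  have fin: "finite ?U"
    by (simp add: finite_plane_trees finite_plane_forests)
  have "(\<Sum>ts\<in>plane_forests n. ?w ts)
      = (\<Sum>ts\<in>(if n = 0 then {[]} else {}). ?w ts) + (\<Sum>ts\<in>(\<lambda>(t, ts). t # ts) ` ?U. ?w ts)"
    unfolding plane_forests_decomp[of n] by (rule sum.union_disjoint) (use fin in auto)
  also have "(\<Sum>ts\<in>(\<lambda>(t, ts). t # ts) ` ?U. ?w ts) = (\<Sum>(t, ts)\<in>?U. f t * ?w ts)"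
    by (subst sum.reindex) (auto simp: inj_on_def intro!: sum.cong)
  also have "\<dots> = (\<Sum>i\<le>n. \<Sum>(t, ts)\<in>plane_trees i \<times> plane_forests (n - i). f t * ?w ts)"
    by (rule sum.UNION_disjoint)
       (simp_all add: finite_plane_trees finite_plane_forests, auto simp: plane_trees_def)
  also have "\<dots> = (\<Sum>i\<le>n. (\<Sum>t\<in>plane_trees i. f t) * (\<Sum>ts\<in>plane_forests (n - i). ?w ts))"
    by (simp add: sum_product sum.cartesian_product)
  finally show "forest_gf f $ n = (1 + tree_gf f * forest_gf f) $ n"
    by (simp add: forest_gf_def tree_gf_def fps_mult_nth atLeast0AtMost)
qed

lemma forest_gf_mult: "forest_gf f * (1 - tree_gf f) = 1"
  using forest_gf_eq[of f] by (simp add: algebra_simps)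

definition low_gf :: "nat \<Rightarrow> 'a::comm_ring_1 fps" where
  "low_gf r = tree_gf (\<lambda>t. of_bool (\<not> tall r t))"

lemma low_gf_0: "low_gf 0 = 0"
  by (simp add: low_gf_def tree_gf_def fps_eq_iff)

lemma prod_list_of_bool: "prod_list (map (\<lambda>x. of_bool (P x)) xs) = (of_bool (\<forall>x\<in>set xs. P x) :: 'a::comm_ring_1)"
  by (induction xs) auto

text \<open>
  All subtrees at the root of a tree of height less than \<open>r + 1\<close> have height less than \<open>r\<close>.
\<close>

lemma low_gf_Suc:
  "low_gf (Suc r) = fps_X * forest_gf (\<lambda>t. of_bool (\<not> tall r t))"
proof (rule fps_ext)
  fix n
  show "(low_gf (Suc r) :: 'a fps) $ n = (fps_X * forest_gf (\<lambda>t. of_bool (\<not> tall r t))) $ n"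
    by (cases n) (simp_all add: low_gf_def tree_gf_def forest_gf_def plane_trees_0
         sum_plane_trees_Suc prod_list_of_bool)
qed

lemma prod_list_power: "prod_list (map (\<lambda>x. v ^ f x) xs) = (v :: 'a::comm_ring_1) ^ sum_list (map f xs)"
  by (induction xs) (simp_all add: power_add)

lemma tall_subtree: "tall r s \<Longrightarrow> s \<in> set ts \<Longrightarrow> tall r (PNode ts)"
proof (induction r arbitrary: s ts)
  case (Suc r)
  then obtain u where "u \<in> set (children s)" "tall r u"
    by auto
  then have "tall r s"
    using Suc.IH[of u "children s"] by simp
  then show ?case
    using Suc.prems by auto
qed simp

lemma not_tall_imp_no_tall_nodes: "\<not> tall r t \<Longrightarrow> tall_nodes r t = 0"
proof (induction t)
  case (PNode ts)
  then have "\<not> tall r s" if "s \<in> set ts" for s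
    using tall_subtree that by blast
  with PNode show ?case
    by (simp del: tall.simps)
qed

text \<open>
  If all roots had the weight \<open>v\<close>, the recursive structure would give \<open>A = v z / (1 - A)\<close>. The root is
  not marked in the trees of height less than \<open>r\<close>, whose other nodes are unmarked as well, so these trees
  contribute the correction \<open>(1 - v) B\<close>. The equation is stated after multiplication by \<open>1 - A\<close>.
\<close>

lemma tree_gf_functional_equation:
  fixes v :: "'a::comm_ring_1" and r :: nat
  defines "A \<equiv> tree_gf (\<lambda>t. v ^ tall_nodes r t)"
  shows "A * (1 - A) = fps_const (1 - v) * low_gf r * (1 - A) + fps_const v * fps_X"
proof -
  let ?L = "forest_gf (\<lambda>t. v ^ tall_nodes r t)"
  have wt: "v ^ tall_nodes r (PNode ts) = v * v ^ sum_list (map (tall_nodes r) ts)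
      + (1 - v) * of_bool (\<not> tall r (PNode ts))" for ts
  proof (cases "tall r (PNode ts)")
    case False
    from not_tall_imp_no_tall_nodes[OF this] have "sum_list (map (tall_nodes r) ts) = 0"
      by (simp only: tall_nodes.simps add_is_0)
    then show ?thesis
      using False by (simp only: tall_nodes.simps) (simp del: tall.simps sum_list_eq_0_iff)
  qed (simp del: tall.simps)
  have "A = fps_const (1 - v) * low_gf r + fps_const v * (fps_X * ?L)"
  proof (rule fps_ext)
    fix n
    show "A $ n = (fps_const (1 - v) * low_gf r + fps_const v * (fps_X * ?L)) $ n"
    proof (cases n)
      case (Suc m)
      then show ?thesis
        by (simp add: A_def low_gf_def tree_gf_def forest_gf_def sum_plane_trees_Suc wt
            prod_list_power sum.distrib sum_distrib_left algebra_simps sum_subtractf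
            del: tall.simps tall_nodes.simps)
    qed (simp add: A_def low_gf_def tree_gf_def forest_gf_def plane_trees_0)
  qed
  then have "A * (1 - A) = (fps_const (1 - v) * low_gf r + fps_const v * (fps_X * ?L)) * (1 - A)"
    by (rule arg_cong)
  also have "\<dots> = fps_const (1 - v) * low_gf r * (1 - A) + fps_const v * fps_X * (?L * (1 - A))"
    by (simp only: distrib_right mult.assoc)
  also have "?L * (1 - A) = 1"
    unfolding A_def by (rule forest_gf_mult)
  finally show ?thesis
    by simp
qed

section \<open>The discriminant of the bivariate generating function\<close>

text \<open>
  Trees are decomposed by size, so \<open>z\<close> is at first the outer variable and the coefficients are polynomials
  in \<open>w\<close>. The analysis fixes a power of \<open>w\<close> and treats its coefficient as a series in \<open>z\<close>. This ring
  isomorphism exchanges the two variables.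
\<close>

definition fps_swap :: "'a::comm_ring_1 fps fps \<Rightarrow> 'a fps fps" where
  "fps_swap F = Abs_fps (\<lambda>i. Abs_fps (\<lambda>j. F $ j $ i))"

lemma fps_swap_nth [simp]: "fps_swap F $ i $ j = F $ j $ i"
  by (simp add: fps_swap_def)

lemma fps_swap_eqI: "(\<And>i j. F $ j $ i = G $ i $ j) \<Longrightarrow> fps_swap F = G"
  by (intro fps_ext) simp

lemma fps_swap_add: "fps_swap (F + G) = fps_swap F + fps_swap G"
  by (rule fps_swap_eqI) simp

lemma fps_swap_diff: "fps_swap (F - G) = fps_swap F - fps_swap G"
  by (rule fps_swap_eqI) simp

lemma fps_swap_mult: "fps_swap (F * G) = fps_swap F * fps_swap G"
proof (rule fps_swap_eqI)
  fix i j
  have "(F * G) $ j $ i = (\<Sum>k=0..j. \<Sum>l=0..i. F $ k $ l * G $ (j - k) $ (i - l))"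
    by (simp add: fps_mult_nth fps_sum_nth)
  also have "\<dots> = (\<Sum>l=0..i. \<Sum>k=0..j. F $ k $ l * G $ (j - k) $ (i - l))"
    by (rule sum.swap)
  finally show "(F * G) $ j $ i = (fps_swap F * fps_swap G) $ i $ j"
    by (simp add: fps_mult_nth fps_sum_nth)
qed

lemma fps_swap_1: "fps_swap 1 = 1"
  by (rule fps_swap_eqI) (simp add: fps_one_nth)

lemma fps_swap_X: "fps_swap fps_X = fps_const fps_X"
  by (rule fps_swap_eqI) (simp add: fps_X_def)

lemma fps_swap_const_X: "fps_swap (fps_const fps_X) = fps_X"
  by (rule fps_swap_eqI) (simp add: fps_X_def)

lemma fps_swap_low_gf: "fps_swap (low_gf r) = fps_const (low_gf r)"
  by (rule fps_swap_eqI) (simp add: low_gf_def tree_gf_def fps_sum_nth of_bool_def if_distrib[of "\<lambda>x. x $ _"] fps_one_nth cong: if_cong)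

lemma one_plus_X_power_nth: "(1 + fps_X :: real fps) ^ m $ d = real (m choose d)"
  by (simp add: fps_binomial_of_nat [symmetric] binomial_gbinomial)

definition moment_gf :: "nat \<Rightarrow> real fps fps" where
  "moment_gf r = fps_swap (tree_gf (\<lambda>t. (1 + fps_X) ^ tall_nodes r t))"

text \<open>
  Because \<open>v = 1 + w\<close>, the coefficients in \<open>w\<close> are sums of binomial coefficients of the cut size, and thus
  factorial moments up to normalisation.
\<close>

lemma moment_gf_nth: "moment_gf r $ d $ n = (\<Sum>t\<in>plane_trees n. real (tall_nodes r t choose d))"
  by (simp add: moment_gf_def tree_gf_def fps_sum_nth one_plus_X_power_nth)

abbreviation low :: "nat \<Rightarrow> real fps" where "low \<equiv> low_gf"

lemma moment_gf_eq:
  "moment_gf r * (1 - moment_gf r)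
     = (1 + fps_X) * fps_const fps_X - fps_X * fps_const (low r) * (1 - moment_gf r)"
proof -
  define A :: "real fps fps" where "A = tree_gf (\<lambda>t. (1 + fps_X) ^ tall_nodes r t)"
  have H: "moment_gf r = fps_swap A"
    by (simp add: moment_gf_def A_def)
  have "A * (1 - A) = fps_const (1 - (1 + fps_X)) * low_gf r * (1 - A) + fps_const (1 + fps_X) * fps_X"
    unfolding A_def by (rule tree_gf_functional_equation)
  also have "\<dots> = (1 + fps_const fps_X) * fps_X - fps_const fps_X * low_gf r * (1 - A)"
    by (simp add: algebra_simps flip: fps_const_neg fps_const_add)
  finally have "fps_swap (A * (1 - A))
      = fps_swap ((1 + fps_const fps_X) * fps_X - fps_const fps_X * low_gf r * (1 - A))"
    by simp
  then show ?thesis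
    unfolding H by (simp only: fps_swap_mult fps_swap_diff fps_swap_add fps_swap_1 fps_swap_X
        fps_swap_const_X fps_swap_low_gf)
qed

definition disc_root :: "nat \<Rightarrow> real fps fps" where
  "disc_root r = 1 - fps_X * fps_const (low r) - 2 * moment_gf r"

text \<open>
  Completing the square in the quadratic equation for \<open>moment_gf\<close>.
\<close>

lemma disc_root_square:
  "disc_root r * disc_root r
     = fps_const (1 - 4 * fps_X) + fps_X * fps_const (2 * low r - 4 * fps_X)
       + fps_X * fps_X * fps_const (low r * low r)"
proof -
  let ?H = "moment_gf r" and ?W = "fps_X :: real fps fps" and ?B = "fps_const (low r)"
    and ?Z = "fps_const fps_X :: real fps fps"
  have 1: "fps_const (1 - 4 * fps_X) = 1 - 4 * ?Z" "fps_const (2 * low r - 4 * fps_X) = 2 * ?B - 4 * ?Z"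
       "fps_const (low r * low r) = ?B * ?B"
    by (simp_all add: fps_const_mult[symmetric] fps_const_sub[symmetric] numeral_fps_const del: fps_const_mult fps_const_sub)
  have "(1 - ?W * ?B - 2 * ?H) * (1 - ?W * ?B - 2 * ?H)
      = (1 - ?W * ?B) * (1 - ?W * ?B) + 4 * (?W * ?B) - 4 * (?H * (1 - ?H) + ?W * ?B * (1 - ?H))"
    by (simp add: algebra_simps)
  also have "?H * (1 - ?H) + ?W * ?B * (1 - ?H) = (1 + ?W) * ?Z"
    using moment_gf_eq[of r] by simp
  finally show ?thesis
    unfolding disc_root_def 1 by (simp add: algebra_simps)
qed

section \<open>Binomial series and factoring out the singularity\<close>

text \<open>
  The binomial series of \<open>(1 + c z)\<close> to the power \<open>a\<close>.
\<close>

definition lin_pow :: "real \<Rightarrow> real \<Rightarrow> real fps" where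
  "lin_pow c a = Abs_fps (\<lambda>n. (a gchoose n) * c ^ n)"

lemma lin_pow_nth: "lin_pow c a $ n = (a gchoose n) * c ^ n"
  by (simp add: lin_pow_def)

lemma lin_pow_mult: "lin_pow c a * lin_pow c b = lin_pow c (a + b)"
proof -
  have eq: "lin_pow c a = fps_compose (fps_binomial a) (fps_const c * fps_X)" for a
    by (simp only: lin_pow_def fps_compose_linear) (simp add: mult.commute)
  show ?thesis
    unfolding eq fps_binomial_add_mult by (rule fps_compose_mult_distrib[symmetric]) simp
qed

lemma lin_pow_0: "lin_pow c 0 = 1"
  by (rule fps_ext) (simp add: lin_pow_nth gbinomial_0_left)

lemma lin_pow_1: "lin_pow c 1 = 1 + fps_const c * fps_X"
proof (rule fps_ext)
  fix n
  show "lin_pow c 1 $ n = (1 + fps_const c * fps_X) $ n"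
    using binomial_gbinomial[of 1 n, where 'a = real]
    by (cases n; cases "n - 1") (auto simp: lin_pow_nth fps_X_def)
qed

abbreviation Y :: "real fps" where "Y \<equiv> 1 - 4 * fps_X"

abbreviation Ypow :: "real \<Rightarrow> real fps" where "Ypow \<equiv> lin_pow (- 4)"

lemma Ypow_1: "Ypow 1 = Y"
  by (simp add: lin_pow_1 numeral_fps_const flip: fps_const_neg)

lemma moment_gf_no_empty_tree: "moment_gf r $ d $ 0 = 0"
  by (simp add: moment_gf_nth plane_trees_0)

text \<open>
  At \<open>w = 0\<close> the discriminant is \<open>1 - 4 z\<close>; of its two square roots, the constant term selects the one
  belonging to the generating function of plane trees.
\<close>

lemma disc_root_0: "disc_root r $ 0 = Ypow (1 / 2)"
proof -
  have "disc_root r $ 0 * disc_root r $ 0 = Ypow (1 / 2) * Ypow (1 / 2)"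
    using arg_cong[OF disc_root_square[of r], of "\<lambda>F. F $ 0"]
    by (simp add: lin_pow_mult Ypow_1)
  then have "disc_root r $ 0 = Ypow (1 / 2) \<or> disc_root r $ 0 = - Ypow (1 / 2)"
    by (simp add: square_eq_iff)
  moreover have "disc_root r $ 0 \<noteq> - Ypow (1 / 2)"
  proof
    assume *: "disc_root r $ 0 = - Ypow (1 / 2)"
    have "disc_root r $ 0 $ 0 = 1 - 2 * moment_gf r $ 0 $ 0"
      unfolding disc_root_def mult_2 by simp
    then show False
      unfolding * by (simp add: lin_pow_nth moment_gf_no_empty_tree)
  qed
  ultimately show ?thesis by blast
qed

text \<open>
  Here \<open>w\<close> is replaced by \<open>Y w\<close> and the result is divided by the value at \<open>w = 0\<close>. This removes all
  half-integer powers of \<open>Y\<close>, as the square of the new series shows.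
\<close>

definition reduced_root :: "nat \<Rightarrow> real fps fps" where
  "reduced_root r = Abs_fps (\<lambda>d. Ypow (real d - 1 / 2) * disc_root r $ d)"

lemma disc_root_eq_reduced: "disc_root r $ d = Ypow (1 / 2 - real d) * reduced_root r $ d"
proof -
  have "Ypow (1 / 2 - real d) * Ypow (real d - 1 / 2) = 1"
    unfolding lin_pow_mult by (simp add: lin_pow_0)
  then show ?thesis
    unfolding reduced_root_def fps_nth_Abs_fps mult.assoc[symmetric] by simp
qed

lemma reduced_root_0: "reduced_root r $ 0 = 1"
  unfolding reduced_root_def fps_nth_Abs_fps disc_root_0 lin_pow_mult by (simp add: lin_pow_0)

lemma quadratic_fps_nth:
  fixes a b c :: "'a::comm_ring_1"
  shows "(fps_const a + fps_X * fps_const b + fps_X * fps_X * fps_const c) $ d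
     = (if d = 0 then a else if d = 1 then b else if d = 2 then c else 0)"
proof -
  have "(fps_X * (fps_X * fps_const c)) $ d = (if d = 2 then c else 0)"
    unfolding fps_X_mult_nth by auto
  moreover have "(fps_X * fps_const b) $ d = (if d = 1 then b else 0)"
    unfolding fps_X_mult_nth by auto
  ultimately show ?thesis
    by (simp add: mult.assoc)
qed

lemma reduced_root_square:
  "reduced_root r * reduced_root r
     = 1 + fps_X * fps_const (2 * low r - 4 * fps_X) + fps_X * fps_X * fps_const (Y * (low r * low r))"
    (is "_ = ?R")
proof (rule fps_ext)
  fix d
  have pw: "Ypow (real i - 1 / 2) * Ypow (real (d - i) - 1 / 2) = Ypow (real d - 1)" if "i \<le> d" for i
    using that by (simp add: lin_pow_mult of_nat_diff)
  have "(reduced_root r * reduced_root r) $ d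
      = (\<Sum>i=0..d. (Ypow (real i - 1 / 2) * Ypow (real (d - i) - 1 / 2)) * (disc_root r $ i * disc_root r $ (d - i)))"
    by (simp add: fps_mult_nth reduced_root_def mult_ac)
  also have "\<dots> = (\<Sum>i=0..d. Ypow (real d - 1) * (disc_root r $ i * disc_root r $ (d - i)))"
    by (intro sum.cong refl) (simp only: pw atLeastAtMost_iff)
  also have "\<dots> = Ypow (real d - 1) * (disc_root r * disc_root r) $ d"
    by (simp add: fps_mult_nth sum_distrib_left)
  also have "\<dots> = ?R $ d"
  proof -
    have "Ypow (- 1) * Y = 1"
      by (simp only: lin_pow_mult flip: Ypow_1) (simp add: lin_pow_0)
    then show ?thesis
      unfolding disc_root_square quadratic_fps_nth fps_const_1_eq_1[symmetric]
      by (simp add: lin_pow_0 Ypow_1)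
  qed
  finally show "(reduced_root r * reduced_root r) $ d = ?R $ d" .
qed

section \<open>Power series that converge beyond the singularity\<close>

text \<open>
  The series that converge beyond the dominant singularity \<open>1/4\<close>. They form a ring.
\<close>

definition radius_gt_quarter :: "real fps \<Rightarrow> bool" where
  "radius_gt_quarter f \<longleftrightarrow> fps_conv_radius f > ereal (1 / 4)"

lemma radius_gt_quarter_const [simp, intro]: "radius_gt_quarter (fps_const c)"
  by (simp add: radius_gt_quarter_def)

lemma radius_gt_quarter_X [simp, intro]: "radius_gt_quarter fps_X"
  by (simp add: radius_gt_quarter_def)

lemma radius_gt_quarter_1 [simp, intro]: "radius_gt_quarter 1"
  by (simp add: radius_gt_quarter_def)

lemma radius_gt_quarter_0 [simp, intro]: "radius_gt_quarter 0"
  by (simp add: radius_gt_quarter_def)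

lemma radius_gt_quarter_numeral [simp, intro]: "radius_gt_quarter (numeral k)"
  by (simp add: radius_gt_quarter_def)

lemma radius_gt_quarter_add [intro]: "radius_gt_quarter f \<Longrightarrow> radius_gt_quarter g \<Longrightarrow> radius_gt_quarter (f + g)"
  unfolding radius_gt_quarter_def using fps_conv_radius_add[of f g] by (auto elim!: less_le_trans[rotated])

lemma radius_gt_quarter_diff [intro]: "radius_gt_quarter f \<Longrightarrow> radius_gt_quarter g \<Longrightarrow> radius_gt_quarter (f - g)"
  unfolding radius_gt_quarter_def using fps_conv_radius_diff[of f g] by (auto elim!: less_le_trans[rotated])

lemma radius_gt_quarter_mult [intro]: "radius_gt_quarter f \<Longrightarrow> radius_gt_quarter g \<Longrightarrow> radius_gt_quarter (f * g)"
  unfolding radius_gt_quarter_def using fps_conv_radius_mult[of f g] by (auto elim!: less_le_trans[rotated])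

lemma radius_gt_quarter_Y [simp, intro]: "radius_gt_quarter Y"
  by (intro radius_gt_quarter_diff radius_gt_quarter_mult) auto

text \<open>
  The ideal of series that vanish to second order at \<open>z = 1/4\<close>. Working modulo this ideal amounts to
  keeping the value and the first derivative at \<open>1/4\<close>.
\<close>

definition divisible_by_Y2 :: "real fps \<Rightarrow> bool" where
  "divisible_by_Y2 f \<longleftrightarrow> (\<exists>q. radius_gt_quarter q \<and> f = Y * Y * q)"

lemma divisible_by_Y2I: "radius_gt_quarter q \<Longrightarrow> f = Y * Y * q \<Longrightarrow> divisible_by_Y2 f"
  by (auto simp: divisible_by_Y2_def)

lemma divisible_by_Y2_0 [simp, intro]: "divisible_by_Y2 0"
  by (rule divisible_by_Y2I[of 0]) auto

lemma divisible_by_Y2_radius: "divisible_by_Y2 f \<Longrightarrow> radius_gt_quarter f"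
  by (auto simp: divisible_by_Y2_def)

lemma divisible_by_Y2_add [intro]: "divisible_by_Y2 f \<Longrightarrow> divisible_by_Y2 g \<Longrightarrow> divisible_by_Y2 (f + g)"
  unfolding divisible_by_Y2_def by (metis distrib_left radius_gt_quarter_add)

lemma divisible_by_Y2_diff [intro]: "divisible_by_Y2 f \<Longrightarrow> divisible_by_Y2 g \<Longrightarrow> divisible_by_Y2 (f - g)"
  unfolding divisible_by_Y2_def by (metis right_diff_distrib radius_gt_quarter_diff)

lemma divisible_by_Y2_mult [intro]: "divisible_by_Y2 f \<Longrightarrow> radius_gt_quarter g \<Longrightarrow> divisible_by_Y2 (f * g)"
  unfolding divisible_by_Y2_def by (metis mult.assoc radius_gt_quarter_mult)

lemma divisible_by_Y2_sum: "(\<And>i. i \<in> A \<Longrightarrow> divisible_by_Y2 (f i)) \<Longrightarrow> divisible_by_Y2 (\<Sum>i\<in>A. f i)"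
  by (induction A rule: infinite_finite_induct) auto

text \<open>
  The left-hand side runs over the pairs \<open>(i, j)\<close> with \<open>i + j\<close> at most \<open>N\<close>, which lie in the square
  that the right-hand side runs over.
\<close>

lemma partial_sum_mult_le:
  fixes f g :: "real fps"
  assumes "\<rho> \<ge> 0" "\<And>n. f $ n \<ge> 0" "\<And>n. g $ n \<ge> 0"
  shows "(\<Sum>n\<le>N. (f * g) $ n * \<rho> ^ n) \<le> (\<Sum>n\<le>N. f $ n * \<rho> ^ n) * (\<Sum>n\<le>N. g $ n * \<rho> ^ n)"
proof -
  have "(\<Sum>n\<le>N. (f * g) $ n * \<rho> ^ n)
      = (\<Sum>n\<le>N. \<Sum>i\<le>n. (f $ i * \<rho> ^ i) * (g $ (n - i) * \<rho> ^ (n - i)))"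
  proof (intro sum.cong refl)
    fix n
    have "\<rho> ^ n = \<rho> ^ i * \<rho> ^ (n - i)" if "i \<le> n" for i
      using that by (simp flip: power_add)
    then have "f $ i * g $ (n - i) * \<rho> ^ n = f $ i * \<rho> ^ i * (g $ (n - i) * \<rho> ^ (n - i))"
      if "i \<le> n" for i
      using that by (simp only: mult_ac)
    then show "(f * g) $ n * \<rho> ^ n = (\<Sum>i\<le>n. (f $ i * \<rho> ^ i) * (g $ (n - i) * \<rho> ^ (n - i)))"
      unfolding fps_mult_nth atLeast0AtMost sum_distrib_right by (intro sum.cong refl) simp
  qed
  also have "\<dots> = (\<Sum>(i, j)\<in>{(i, j). i + j \<le> N}. (f $ i * \<rho> ^ i) * (g $ j * \<rho> ^ j))"
    by (rule sum.triangle_reindex_eq [symmetric])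
  also have "\<dots> \<le> (\<Sum>(i, j)\<in>{..N} \<times> {..N}. (f $ i * \<rho> ^ i) * (g $ j * \<rho> ^ j))"
    by (rule sum_mono2) (use assms in auto)
  also have "\<dots> = (\<Sum>n\<le>N. f $ n * \<rho> ^ n) * (\<Sum>n\<le>N. g $ n * \<rho> ^ n)"
    by (simp add: sum_product sum.cartesian_product)
  finally show ?thesis .
qed

lemma radius_gt_quarter_if_bounded_partial_sums:
  assumes "\<rho> > 1 / 4" "\<And>n. f $ n \<ge> 0" "\<And>N. (\<Sum>n\<le>N. f $ n * \<rho> ^ n) \<le> C"
  shows "radius_gt_quarter f"
proof -
  have "summable (\<lambda>n. f $ n * \<rho> ^ n)"
  proof (rule summableI_nonneg_bounded)
    fix n
    show "(\<Sum>i<n. f $ i * \<rho> ^ i) \<le> C"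
      by (rule order_trans[OF _ assms(3)[of n]], rule sum_mono2) (use assms in auto)
  qed (use assms in auto)
  then have "fps_conv_radius f \<ge> ereal (norm \<rho>)"
    unfolding fps_conv_radius_def by (rule conv_radius_geI)
  moreover have "ereal (1 / 4) < ereal (norm \<rho>)"
    using assms(1) by simp
  ultimately show ?thesis
    unfolding radius_gt_quarter_def by (rule less_le_trans[rotated])
qed

section \<open>Trees of bounded height\<close>

definition low_forest :: "nat \<Rightarrow> real fps" where
  "low_forest r = forest_gf (\<lambda>t. of_bool (\<not> tall r t))"

lemma low_forest_nonneg: "low_forest r $ n \<ge> 0"
  by (simp add: low_forest_def forest_gf_def prod_list_of_bool sum_nonneg)

lemma low_nonneg: "low r $ n \<ge> 0"
  by (simp add: low_gf_def tree_gf_def sum_nonneg)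

lemma low_Suc: "low (Suc r) = fps_X * low_forest r"
  by (simp add: low_gf_Suc low_forest_def)

lemma low_forest_eq: "low_forest r = 1 + low r * low_forest r"
  unfolding low_forest_def by (subst forest_gf_eq) (simp add: low_gf_def)

text \<open>
  Truncating the identity \<open>F = 1 + B F\<close> at degree \<open>N\<close> gives \<open>s \<le> 1 + \<beta> s\<close> for the finite partial sum \<open>s\<close>
  of \<open>F\<close>, so convergence need not be known in advance.
\<close>

lemma low_forest_partial_sum:
  assumes "\<rho> \<ge> 0" "\<beta> < 1" "(\<Sum>n\<le>N. low r $ n * \<rho> ^ n) \<le> \<beta>"
  shows "(\<Sum>n\<le>N. low_forest r $ n * \<rho> ^ n) \<le> 1 / (1 - \<beta>)"
proof -
  let ?s = "\<Sum>n\<le>N. low_forest r $ n * \<rho> ^ n"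
  have pos: "?s \<ge> 0"
    using assms low_forest_nonneg by (intro sum_nonneg) auto
  have "?s = (\<Sum>n\<le>N. (1 + low r * low_forest r) $ n * \<rho> ^ n)"
    using low_forest_eq[of r] by simp
  also have "\<dots> = (\<Sum>n\<le>N. of_bool (n = 0)) + (\<Sum>n\<le>N. (low r * low_forest r) $ n * \<rho> ^ n)"
    unfolding sum.distrib[symmetric]
    by (intro sum.cong refl) (simp add: algebra_simps fps_one_nth)
  also have "(\<Sum>n\<le>N. of_bool (n = 0)) = (1 :: real)"
    by (simp add: of_bool_def)
  also have "(\<Sum>n\<le>N. (low r * low_forest r) $ n * \<rho> ^ n) \<le> (\<Sum>n\<le>N. low r $ n * \<rho> ^ n) * ?s"
    by (rule partial_sum_mult_le) (use assms low_nonneg low_forest_nonneg in auto)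
  also have "\<dots> \<le> \<beta> * ?s"
    using assms(3) pos by (rule mult_right_mono)
  finally have "?s * (1 - \<beta>) \<le> 1"
    by (simp add: algebra_simps)
  then show ?thesis
    using assms(2) by (simp add: pos_le_divide_eq)
qed

text \<open>
  Trees of bounded height are exponentially rarer than all trees. The value of \<open>B\<close> at \<open>1/4\<close> stays below
  \<open>1/2\<close>: if it is at most \<open>\<beta> < 1/2\<close>, then the next one is at most \<open>(1/4) / (1 - \<beta>) < 1/2\<close>. The strict
  inequality leaves room to move the evaluation point slightly to the right of \<open>1/4\<close>, by an amount that
  depends on \<open>r\<close>.
\<close>

lemma low_partial_sums:
  "\<exists>\<rho>>1 / 4. \<exists>\<beta><1 / 2. \<forall>N. (\<Sum>n\<le>N. low r $ n * \<rho> ^ n) \<le> \<beta>"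
proof (induction r)
  case 0
  show ?case
    by (intro exI[of _ 1] conjI exI[of _ 0]) (simp_all add: low_gf_0)
next
  case (Suc r)
  then obtain \<rho> \<beta> where \<rho>: "\<rho> > 1 / 4" and \<beta>: "\<beta> < 1 / 2"
    and le: "\<And>N. (\<Sum>n\<le>N. low r $ n * \<rho> ^ n) \<le> \<beta>"
    by blast
  (* The bound (1 - \<beta>) / 2 > 1/4 makes the next value \<sigma> / (1 - \<beta>) smaller than 1/2. *)
  obtain \<sigma> where \<sigma>: "1 / 4 < \<sigma>" "\<sigma> < min \<rho> ((1 - \<beta>) / 2)"
    using dense[of "1 / 4" "min \<rho> ((1 - \<beta>) / 2)"] \<rho> \<beta> by auto
  have "(\<Sum>n\<le>N. low (Suc r) $ n * \<sigma> ^ n) \<le> \<sigma> * (1 / (1 - \<beta>))" for N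
  proof -
    have "(\<Sum>n\<le>N. low r $ n * \<sigma> ^ n) \<le> (\<Sum>n\<le>N. low r $ n * \<rho> ^ n)"
      using \<sigma> low_nonneg by (intro sum_mono mult_left_mono power_mono) auto
    with le have "(\<Sum>n\<le>N. low r $ n * \<sigma> ^ n) \<le> \<beta>"
      using order_trans by blast
    then have forest: "(\<Sum>n\<le>N. low_forest r $ n * \<sigma> ^ n) \<le> 1 / (1 - \<beta>)"
      using \<sigma> \<beta> by (intro low_forest_partial_sum) auto
    have X: "(\<Sum>n\<le>N. fps_X $ n * \<sigma> ^ n) \<le> \<sigma>"
      using \<sigma> by (cases N) (auto simp: fps_X_def if_distrib[of "\<lambda>x. x * _"] cong: if_cong)
    have "(\<Sum>n\<le>N. low (Suc r) $ n * \<sigma> ^ n)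
        \<le> (\<Sum>n\<le>N. fps_X $ n * \<sigma> ^ n) * (\<Sum>n\<le>N. low_forest r $ n * \<sigma> ^ n)"
      unfolding low_Suc
      by (rule partial_sum_mult_le) (use \<sigma> low_forest_nonneg in \<open>auto simp: fps_X_def\<close>)
    also have "\<dots> \<le> \<sigma> * (1 / (1 - \<beta>))"
      using X forest \<sigma> low_forest_nonneg by (intro mult_mono) (auto intro!: sum_nonneg)
    finally show ?thesis .
  qed
  moreover have "\<sigma> * (1 / (1 - \<beta>)) < 1 / 2"
    using \<sigma> \<beta> by (simp add: field_simps)
  ultimately show ?case
    using \<sigma> by blast
qed

lemma radius_gt_quarter_low: "radius_gt_quarter (low r)"
  using low_partial_sums[of r] radius_gt_quarter_if_bounded_partial_sums low_nonneg by metis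

lemma radius_gt_quarter_low_forest: "radius_gt_quarter (low_forest r)"
proof -
  obtain \<rho> \<beta> where \<rho>: "\<rho> > 1 / 4" and \<beta>: "\<beta> < 1 / 2"
    and le: "\<And>N. (\<Sum>n\<le>N. low r $ n * \<rho> ^ n) \<le> \<beta>"
    using low_partial_sums[of r] by blast
  have "(\<Sum>n\<le>N. low_forest r $ n * \<rho> ^ n) \<le> 1 / (1 - \<beta>)" for N
    using \<rho> \<beta> le by (intro low_forest_partial_sum) auto
  then show ?thesis
    using \<rho> low_forest_nonneg by (intro radius_gt_quarter_if_bounded_partial_sums)
qed

text \<open>
  The value of \<open>low r\<close> at \<open>z = 1/4\<close>; its derivative there with respect to \<open>Y\<close> is \<open>low_c1 r\<close>.
\<close>

definition low_c0 :: "nat \<Rightarrow> real" where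
  "low_c0 r = real r / (2 * (real r + 1))"

definition low_c1 :: "nat \<Rightarrow> real" where
  "low_c1 r = - real r * (real r + 2) / (6 * (real r + 1))"

text \<open>
  The recursion \<open>C (1 - B) = z\<close>, with \<open>C\<close> for height \<open>r + 1\<close>, determines the first two coefficients of
  \<open>C\<close> in powers of \<open>Y\<close> from those of \<open>B\<close>. The quotient \<open>1 / (1 - B)\<close> is a generating function of forests, which has radius greater
  than \<open>1/4\<close>, so dividing by \<open>1 - B\<close> preserves the ideal.
\<close>

lemma low_expansion: "divisible_by_Y2 (low r - fps_const (low_c0 r) - fps_const (low_c1 r) * Y)"
proof (induction r)
  case 0
  then show ?case
    by (simp add: low_gf_0 low_c0_def low_c1_def)
next
  case (Suc r)
  let ?a = "low_c0 r" and ?b = "low_c1 r" and ?a' = "low_c0 (Suc r)" and ?b' = "low_c1 (Suc r)"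
  define E where "E = low r - fps_const ?a - fps_const ?b * Y"
  define D where "D = fps_const ?a' + fps_const ?b' * Y"
  have c0: "?a' * (1 - ?a) = 1 / 4" and c1: "?b' * (1 - ?a) - ?a' * ?b = - 1 / 4"
    by (simp_all add: low_c0_def low_c1_def divide_simps) (simp_all add: algebra_simps)
  have X: "fps_X = fps_const (1 / 4) + fps_const (- 1 / 4) * Y"
    by (rule fps_ext) (auto simp: numeral_fps_const fps_X_def)
  have inv: "low_forest r * (1 - low r) = 1"
    using low_forest_eq[of r] by (simp add: algebra_simps)
  have main: "fps_X - D * (1 - low r) = Y * Y * (fps_const (?b' * ?b)) + D * E"
  proof -
    have "D * (1 - low r) = D * (1 - fps_const ?a - fps_const ?b * Y) - D * E"
      by (simp add: E_def algebra_simps)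
    also have "D * (1 - fps_const ?a - fps_const ?b * Y)
        = fps_const (?a' * (1 - ?a)) + fps_const (?b' * (1 - ?a) - ?a' * ?b) * Y - Y * Y * fps_const (?b' * ?b)"
      by (simp add: D_def algebra_simps flip: fps_const_mult fps_const_sub fps_const_add)
    finally show ?thesis
      unfolding c0 c1 using X by simp
  qed
  have "low (Suc r) - D = (fps_X - D * (1 - low r)) * low_forest r"
  proof -
    have "(fps_X - D * (1 - low r)) * low_forest r
        = fps_X * low_forest r - D * (low_forest r * (1 - low r))"
      by (simp add: algebra_simps)
    then show ?thesis
      by (simp only: inv low_Suc mult_1_right)
  qed
  also have "divisible_by_Y2 \<dots>"
    unfolding main
  proof (rule divisible_by_Y2_mult[OF divisible_by_Y2_add radius_gt_quarter_low_forest])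
    show "divisible_by_Y2 (Y * Y * fps_const (?b' * ?b))"
      by (rule divisible_by_Y2I[OF _ refl]) auto
    have "radius_gt_quarter D"
      unfolding D_def by (intro radius_gt_quarter_add radius_gt_quarter_mult) auto
    moreover have "divisible_by_Y2 E"
      using Suc by (simp add: E_def)
    ultimately show "divisible_by_Y2 (D * E)"
      by (subst mult.commute) (rule divisible_by_Y2_mult)
  qed
  finally show ?case
    by (simp add: D_def diff_diff_eq)
qed

section \<open>The expansion at the singularity\<close>

abbreviation lift :: "real fps \<Rightarrow> real fps fps" where
  "lift f \<equiv> fps_swap (fps_const f)"

lemma lift_nth: "lift f $ d = fps_const (f $ d)"
  by (rule fps_ext) (auto simp: fps_const_def)

lemma lift_mult: "lift (f * g) = lift f * lift g"
  by (simp add: fps_swap_mult flip: fps_const_mult)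

text \<open>
  The square of \<open>reduced_root r\<close> is \<open>1 - w / (r + 1)\<close> at \<open>Y = 0\<close>. Expanding the square root to first order
  in \<open>Y\<close> yields two series in \<open>w\<close> with constant coefficients: \<open>lead0\<close> is the value and \<open>lead1\<close> the
  derivative with respect to \<open>Y\<close>.
\<close>

definition lead0 :: "nat \<Rightarrow> real fps" where
  "lead0 r = lin_pow (- (1 / (real r + 1))) (1 / 2)"

definition lead1 :: "nat \<Rightarrow> real fps" where
  "lead1 r = (fps_const (low_c1 r + 1 / 2) * fps_X + fps_const ((low_c0 r)\<^sup>2 / 2) * fps_X * fps_X)
               * lin_pow (- (1 / (real r + 1))) (- 1 / 2)"

lemma lead0_square: "lead0 r * lead0 r = 1 - fps_const (1 / (real r + 1)) * fps_X"
  unfolding lead0_def lin_pow_mult by (simp add: lin_pow_1 flip: fps_const_neg)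

lemma lead0_lead1:
  "lead0 r * lead1 r = fps_const (low_c1 r + 1 / 2) * fps_X + fps_const ((low_c0 r)\<^sup>2 / 2) * fps_X * fps_X"
proof -
  have "lead0 r * lin_pow (- (1 / (real r + 1))) (- 1 / 2) = 1"
    unfolding lead0_def lin_pow_mult by (simp add: lin_pow_0)
  then show ?thesis
    unfolding lead1_def mult.left_commute[of "lead0 r"] by simp
qed

definition lead :: "nat \<Rightarrow> real fps fps" where
  "lead r = lift (lead0 r) + fps_const Y * lift (lead1 r)"

lemma lead_nth: "lead r $ d = fps_const (lead0 r $ d) + Y * fps_const (lead1 r $ d)"
  by (simp add: lead_def lift_nth)

lemma radius_gt_quarter_lead: "radius_gt_quarter (lead r $ d)"
  unfolding lead_nth by (intro radius_gt_quarter_add radius_gt_quarter_mult) auto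

lemma lead_square:
  "lead r * lead r = lift (lead0 r * lead0 r) + fps_const (2 * Y) * lift (lead0 r * lead1 r)
     + fps_const (Y * Y) * lift (lead1 r * lead1 r)"
proof -
  have "fps_const (2 * Y) = 2 * fps_const Y"
    by (simp add: numeral_fps_const flip: fps_const_mult)
  then show ?thesis
    unfolding lead_def lift_mult fps_const_mult[symmetric, of Y Y] by (simp add: algebra_simps)
qed

lemma low_c0_eq: "2 * low_c0 r - 1 = - (1 / (real r + 1))"
  by (simp add: low_c0_def field_simps)

text \<open>
  \<open>lead0\<close> and \<open>lead1\<close> are chosen such that the squares agree in the terms of order 0 and 1 in \<open>Y\<close>; what
  remains are the error in the expansion of \<open>low r\<close>, the difference of \<open>Y B\<^sup>2\<close> and
  \<open>Y b\<^sup>2\<close>, where \<open>b\<close> is the value of \<open>B\<close> at \<open>1/4\<close>, and the square of the linear term.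
\<close>

lemma square_diff_divisible_by_Y2: "divisible_by_Y2 ((reduced_root r * reduced_root r - lead r * lead r) $ d)"
proof -
  define a b c where "a = low_c0 r" and "b = low_c1 r" and "c = 1 / (real r + 1)"
  define E where "E = low r - fps_const a - fps_const b * Y"
  have E: "divisible_by_Y2 E"
    unfolding E_def a_def b_def by (rule low_expansion)
  have low: "low r = fps_const a + fps_const b * Y + E"
    by (simp add: E_def)
  have c: "2 * a - 1 = - c"
    unfolding a_def c_def by (rule low_c0_eq)
  have lin: "2 * low r - 4 * fps_X = 2 * E + fps_const (- c) + 2 * fps_const (b + 1 / 2) * Y"
  proof -
    have "2 * fps_const (b + 1 / 2) = 2 * fps_const b + 1"
      by (rule fps_ext) (simp add: numeral_fps_const)
    moreover have "fps_const (- c) = 2 * fps_const a - 1"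
      unfolding c[symmetric] by (rule fps_ext) (simp add: numeral_fps_const)
    ultimately show ?thesis
      unfolding low by (simp add: algebra_simps)
  qed
  have 1: "divisible_by_Y2 (2 * E)"
    using divisible_by_Y2_mult[OF E radius_gt_quarter_numeral] by (simp add: mult.commute)
  have 2: "divisible_by_Y2 (Y * (low r * low r) - Y * fps_const (a\<^sup>2))"
  proof -
    have "Y * (low r * low r) - Y * fps_const (a\<^sup>2)
        = Y * Y * (fps_const b * (low r + fps_const a)) + E * (Y * (low r + fps_const a))"
    proof -
      have "y * ((a + b * y + e) * (a + b * y + e)) - y * (a * a)
          = y * y * (b * (a + b * y + e + a)) + e * (y * (a + b * y + e + a))" for y a b e :: "real fps"
        by (simp add: algebra_simps)
      then show ?thesis
        unfolding low power2_eq_square fps_const_mult[symmetric] .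
    qed
    moreover have "divisible_by_Y2 (Y * Y * (fps_const b * (low r + fps_const a)))"
      by (rule divisible_by_Y2I[OF _ refl]) (intro radius_gt_quarter_mult radius_gt_quarter_add radius_gt_quarter_const radius_gt_quarter_low)
    moreover have "divisible_by_Y2 (E * (Y * (low r + fps_const a)))"
      by (rule divisible_by_Y2_mult[OF E]) (intro radius_gt_quarter_mult radius_gt_quarter_add radius_gt_quarter_const radius_gt_quarter_low radius_gt_quarter_Y)
    ultimately show ?thesis
      by auto
  qed
  have 3: "divisible_by_Y2 (Y * Y * fps_const ((lead1 r * lead1 r) $ d))"
    by (rule divisible_by_Y2I[OF _ refl]) simp
  have R: "(reduced_root r * reduced_root r) $ d
      = of_bool (d = 0) + of_bool (d = 1) * (2 * E + (fps_const (- c) + 2 * fps_const (b + 1 / 2) * Y))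
        + of_bool (d = 2) * (Y * (low r * low r))"
    using quadratic_fps_nth[of 1 "2 * low r - 4 * fps_X" "Y * (low r * low r)" d]
    unfolding reduced_root_square fps_const_1_eq_1 lin
    by (cases "d = 0"; cases "d = 1"; cases "d = 2") (simp_all only: if_True if_False, simp_all add: add.assoc)
  have L: "(lead r * lead r) $ d
      = of_bool (d = 0) + of_bool (d = 1) * (fps_const (- c) + 2 * fps_const (b + 1 / 2) * Y)
        + of_bool (d = 2) * (Y * fps_const (a\<^sup>2)) + Y * Y * fps_const ((lead1 r * lead1 r) $ d)"
  proof -
    have 0: "lift (lead0 r * lead0 r) $ d = of_bool (d = 0) + of_bool (d = 1) * fps_const (- c)"
      unfolding lead0_square lift_nth c_def by (rule fps_ext) (auto simp: fps_X_def)
    have "(lead0 r * lead1 r) $ d = of_bool (d = 1) * (b + 1 / 2) + of_bool (d = 2) * (a\<^sup>2 / 2)"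
      unfolding lead0_lead1 a_def b_def
      using quadratic_fps_nth[of 0 "low_c1 r + 1 / 2" "(low_c0 r)\<^sup>2 / 2" d]
      by (simp add: mult_ac)
    then have coeff: "lift (lead0 r * lead1 r) $ d
        = of_bool (d = 1) * fps_const (b + 1 / 2) + of_bool (d = 2) * fps_const (a\<^sup>2 / 2)"
      unfolding lift_nth by (cases "d = 1"; cases "d = 2") simp_all
    have "2 * fps_const (a\<^sup>2 / 2) = fps_const (a\<^sup>2)"
      by (simp add: numeral_fps_const)
    moreover have "2 * y * (u * p + v * q) = u * (2 * p * y) + v * (y * (2 * q))" for y u v p q :: "real fps"
      by (simp add: algebra_simps)
    ultimately have 1: "2 * Y * lift (lead0 r * lead1 r) $ d
        = of_bool (d = 1) * (2 * fps_const (b + 1 / 2) * Y) + of_bool (d = 2) * (Y * fps_const (a\<^sup>2))"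
      unfolding coeff by presburger
    show ?thesis
      unfolding lead_square fps_add_nth fps_mult_left_const_nth 0 1
      by (simp add: lift_nth algebra_simps del: fps_const_mult)
  qed
  have "x + u * (p + q) + v * s - (x + u * q + v * t + w) = u * p + v * (s - t) - w"
    for x u p q v s t w :: "real fps"
    by (simp add: algebra_simps)
  then have eq: "(reduced_root r * reduced_root r - lead r * lead r) $ d
      = of_bool (d = 1) * (2 * E) + of_bool (d = 2) * (Y * (low r * low r) - Y * fps_const (a\<^sup>2))
        - Y * Y * fps_const ((lead1 r * lead1 r) $ d)"
    unfolding fps_sub_nth R L .
  have divisible_by_Y2_bool: "divisible_by_Y2 (of_bool P * f)" if "divisible_by_Y2 f" for P f
    using that by (cases P) auto
  show ?thesis
    unfolding eq by (rule divisible_by_Y2_diff[OF divisible_by_Y2_add[OF divisible_by_Y2_bool[OF 1] divisible_by_Y2_bool[OF 2]] 3])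
qed

text \<open>
  The difference \<open>D\<close> and the sum \<open>T\<close> of the two series satisfy \<open>D T = U\<close> with \<open>U\<close> in the ideal. As \<open>T\<close> has
  the invertible constant term 2 and \<open>D\<close> has none, comparing coefficients of \<open>w\<^sup>d\<close> expresses \<open>D $ d\<close> by
  \<open>U $ d\<close> and earlier coefficients of \<open>D\<close> and \<open>T\<close>.
\<close>

lemma lead_approximates: "divisible_by_Y2 (reduced_root r $ d - lead r $ d)"
proof (induction d rule: less_induct)
  case (less d)
  define D where "D = reduced_root r - lead r"
  define T where "T = reduced_root r + lead r"
  have D0: "D $ 0 = 0"
    by (simp add: D_def reduced_root_0 lead_nth lead0_def lead1_def lin_pow_nth)
  show ?case
  proof (cases "d = 0")
    case True
    then show ?thesis
      using D0 by (simp add: D_def)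
  next
    case False
    have T0: "T $ 0 = 2"
      by (simp add: T_def reduced_root_0 lead_nth lead0_def lead1_def lin_pow_nth)
    have "(D * T) $ d = (\<Sum>i=0..<d. D $ i * T $ (d - i)) + D $ d * T $ 0"
      by (simp add: fps_mult_nth sum.last_plus atLeastLessThanSuc_atLeastAtMost[symmetric])
    also have "(\<Sum>i=0..<d. D $ i * T $ (d - i)) = (\<Sum>i=1..<d. D $ i * T $ (d - i))"
      using False D0 by (simp add: sum.atLeast_Suc_lessThan)
    finally have rec: "2 * D $ d = (D * T) $ d - (\<Sum>i=1..<d. D $ i * T $ (d - i))"
      by (simp add: T0)
    have divD: "divisible_by_Y2 (D $ i)" if "i < d" for i
      using less[OF that] by (simp add: D_def)
    have "radius_gt_quarter (T $ i)" if "i < d" for i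
    proof -
      have "T $ i = D $ i + (lead r $ i + lead r $ i)"
        by (simp add: D_def T_def)
      then show ?thesis
        using divisible_by_Y2_radius[OF divD[OF that]] radius_gt_quarter_lead by auto
    qed
    then have "divisible_by_Y2 (\<Sum>i=1..<d. D $ i * T $ (d - i))"
      using divD by (intro divisible_by_Y2_sum divisible_by_Y2_mult) auto
    moreover have "D * T = reduced_root r * reduced_root r - lead r * lead r"
      by (simp add: D_def T_def algebra_simps)
    then have "divisible_by_Y2 ((D * T) $ d)"
      using square_diff_divisible_by_Y2 by simp
    ultimately have "divisible_by_Y2 (2 * D $ d * fps_const (1 / 2))"
      unfolding rec by (intro divisible_by_Y2_mult divisible_by_Y2_diff) auto
    also have "2 * D $ d * fps_const (1 / 2) = D $ d"
      by (rule fps_ext) (simp add: numeral_fps_const)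
    finally show ?thesis
      by (simp add: D_def)
  qed
qed

section \<open>Growth of coefficients\<close>

lemma pochhammer_minus_half_nonzero: "pochhammer (- 1 / 2 :: real) d \<noteq> 0"
proof
  assume "pochhammer (- 1 / 2 :: real) d = 0"
  then obtain k where "- 1 / 2 = - real k"
    by (auto simp: pochhammer_eq_0_iff)
  then have "real (2 * k) = real 1"
    by simp
  then have "2 * k = 1"
    by (simp only: of_nat_eq_iff)
  then show False
    by presburger
qed

text \<open>
  Lowering the exponent \<open>a\<close> by one multiplies the \<open>n\<close>-th coefficient by \<open>(a - n) / a\<close>, which is a factor
  of the quotient of Pochhammer symbols when \<open>a = 1/2 - d\<close>.
\<close>

lemma Ypow_ratio:
  "Ypow (1 / 2 - real d) $ n = Ypow (1 / 2) $ n * (pochhammer (real n - 1 / 2) d / pochhammer (- 1 / 2) d)"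
proof (induction d)
  case (Suc d)
  define a where "a = 1 / 2 - real d"
  have a: "a \<noteq> 0"
  proof
    assume "a = 0"
    then have "real (2 * d) = real 1"
      by (simp add: a_def)
    then have "2 * d = 1"
      by (simp only: of_nat_eq_iff)
    then show False
      by presburger
  qed
  have "(a - real n) * (a gchoose n) = a * ((a - 1) gchoose n)"
    by (rule gbinomial_absorb_comp)
  with a have "(a - 1) gchoose n = (a gchoose n) * ((a - real n) / a)"
    by (simp add: field_simps)
  then have "Ypow (a - 1) $ n = Ypow a $ n * ((a - real n) / a)"
    by (simp add: lin_pow_nth)
  also have "(a - real n) / a = (real n - 1 / 2 + real d) / (- 1 / 2 + real d)"
    using a by (simp add: a_def divide_simps) (simp add: algebra_simps)
  also have "Ypow a $ n = Ypow (1 / 2) $ n * (pochhammer (real n - 1 / 2) d / pochhammer (- 1 / 2) d)"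
    using Suc by (simp add: a_def)
  finally have "Ypow (a - 1) $ n = Ypow (1 / 2) $ n * (pochhammer (real n - 1 / 2) d / pochhammer (- 1 / 2) d)
      * ((real n - 1 / 2 + real d) / (- 1 / 2 + real d))" .
  also have "\<dots> = Ypow (1 / 2) $ n * (pochhammer (real n - 1 / 2) (Suc d) / pochhammer (- 1 / 2) (Suc d))"
    unfolding pochhammer_Suc times_divide_times_eq[symmetric] by (simp only: mult.assoc)
  finally show ?case
    by (simp add: a_def algebra_simps)
qed simp

lemma Ypow_tendsto:
  "(\<lambda>n. Ypow a $ n / (4 ^ n * real n powr (- a - 1))) \<longlonglongrightarrow> inverse (Gamma (- a))"
proof (rule Lim_transform_eventually[OF gbinomial_asymptotic[of a]])
  show "eventually (\<lambda>n. (a gchoose n) / ((- 1) ^ n / exp ((a + 1) * of_real (ln (real n))))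
      = Ypow a $ n / (4 ^ n * real n powr (- a - 1))) sequentially"
    using eventually_gt_at_top[of 0]
  proof eventually_elim
    case (elim n)
    define E where "E = exp ((a + 1) * ln (real n))"
    have E: "E > 0" "real n powr (- a - 1) = 1 / E"
      using elim by (simp_all add: E_def powr_def algebra_simps exp_add exp_diff exp_minus divide_simps)
    show ?case
      by (cases "even n") (simp_all add: lin_pow_nth E E_def[symmetric])
  qed
qed

lemma Ypow_bigo: "(\<lambda>n. Ypow a $ n) \<in> O(\<lambda>n. 4 ^ n * real n powr (- a - 1))"
  by (rule bigoI_tendsto[OF Ypow_tendsto])
     (use eventually_gt_at_top[of 0] in \<open>auto elim: eventually_mono\<close>)

lemma Ypow_half_bigomega: "(\<lambda>n. Ypow (1 / 2) $ n) \<in> \<Omega>(\<lambda>n. 4 ^ n * real n powr (- 3 / 2))"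
proof -
  have "- (1 / 2 :: real) \<notin> \<int>\<^sub>\<le>\<^sub>0"
  proof
    assume "- (1 / 2 :: real) \<in> \<int>\<^sub>\<le>\<^sub>0"
    then obtain k where "- (1 / 2) = - real k"
      by (auto elim!: nonpos_Ints_cases')
    then have "real (2 * k) = real 1"
      by simp
    then have "2 * k = 1"
      by (simp only: of_nat_eq_iff)
    then show False
      by presburger
  qed
  then have "inverse (Gamma (- (1 / 2 :: real))) \<noteq> 0"
    using Gamma_nonzero by simp
  from bigomegaI_tendsto[OF this Ypow_tendsto] show ?thesis
    by simp
qed

text \<open>
  Polynomial growth is dominated by any exponential: with \<open>\<delta> t \<le> ln x\<close>, the inequality
  \<open>\<delta> m \<le> exp (\<delta> m)\<close> is raised to the power \<open>t\<close>.
\<close>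

lemma powr_le_const_mult_power:
  fixes x t :: real
  assumes "x > 1" "t \<ge> 0"
  obtains C where "C \<ge> 0" "\<And>k. real (Suc k) powr t \<le> C * x ^ k"
proof
  define \<delta> where "\<delta> = ln x / (t + 1)"
  have \<delta>: "\<delta> > 0" "\<delta> * t \<le> ln x"
    using assms by (simp_all add: \<delta>_def field_simps)
  show "x * \<delta> powr (- t) \<ge> 0"
    using assms by simp
  fix k
  let ?m = "real (Suc k)"
  have "\<delta> * ?m \<le> exp (\<delta> * ?m)"
    using exp_ge_add_one_self[of "\<delta> * ?m"] by linarith
  then have "(\<delta> * ?m) powr t \<le> exp (\<delta> * ?m) powr t"
    using \<delta> assms by (intro powr_mono2) auto
  also have "\<dots> = exp (\<delta> * t * ?m)"
    by (simp add: powr_def mult_ac)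
  also have "\<dots> \<le> exp (ln x * ?m)"
    using \<delta> by (simp add: mult_right_mono)
  also have "\<dots> = x * x ^ k"
    using assms exp_of_nat_mult[of "Suc k" "ln x"] by (simp add: mult.commute)
  finally have "\<delta> powr t * ?m powr t \<le> x * x ^ k"
    using \<delta> by (simp add: powr_mult)
  then show "?m powr t \<le> x * \<delta> powr (- t) * x ^ k"
    using \<delta> by (simp add: powr_minus field_simps)
qed

lemma powr_diff_le:
  assumes "k \<le> n"
  shows "real (Suc (n - k)) powr s \<le> real (Suc n) powr s * real (Suc k) powr \<bar>s\<bar>"
proof (cases "s \<ge> 0")
  case True
  have "real (Suc (n - k)) powr s \<le> real (Suc n) powr s"
    using True by (intro powr_mono2) auto
  also have "\<dots> \<le> real (Suc n) powr s * real (Suc k) powr \<bar>s\<bar>"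
    using ge_one_powr_ge_zero[of "real (Suc k)" "\<bar>s\<bar>"] by (simp add: mult_le_cancel_left1)
  finally show ?thesis .
next
  case False
  have "Suc n \<le> Suc (n - k) * Suc k"
    using assms by (auto simp: le_iff_add)
  then have "real (Suc n) \<le> real (Suc (n - k)) * real (Suc k)"
    by (simp only: of_nat_mult[symmetric] of_nat_le_iff)
  then have "real (Suc n) powr (- s) \<le> (real (Suc (n - k)) * real (Suc k)) powr (- s)"
    using False by (intro powr_mono2) auto
  then have "real (Suc n) powr (- s) \<le> real (Suc (n - k)) powr (- s) * real (Suc k) powr (- s)"
    by (simp only: powr_mult of_nat_0_le_iff)
  then show ?thesis
    using False by (simp add: powr_minus field_simps del: of_nat_Suc)
qed

lemma powr_Suc_bigtheta: "(\<lambda>n. real (Suc n) powr s) \<in> \<Theta>(\<lambda>n. real n powr s)"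
proof (rule bigthetaI_tendsto)
  have "(\<lambda>n. (real (Suc n) / real n) powr s) \<longlonglongrightarrow> 1 powr s"
    by (intro tendsto_intros LIMSEQ_Suc_n_over_n) auto
  then show "(\<lambda>n. real (Suc n) powr s / real n powr s) \<longlonglongrightarrow> 1"
    by (simp add: powr_divide)
qed simp

text \<open>
  In the convolution, the coefficients of \<open>q\<close> times \<open>4\<close> to the power \<open>-k\<close> decay exponentially, whereas
  shifting \<open>n\<close> to \<open>n - k\<close> costs only a factor polynomial in \<open>k\<close> (\<open>powr_diff_le\<close>). This replaces the
  transfer theorems of singularity analysis.
\<close>

lemma mult_radius_gt_quarter_bigo:
  assumes f: "(\<lambda>n. f $ n) \<in> O(\<lambda>n. 4 ^ n * real n powr s)" and q: "radius_gt_quarter q"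
  shows "(\<lambda>n. (f * q) $ n) \<in> O(\<lambda>n. 4 ^ n * real n powr s)"
proof -
  define g where "g = (\<lambda>n. 4 ^ n * real (Suc n) powr s)"
  have g: "g \<in> \<Theta>(\<lambda>n. 4 ^ n * real n powr s)"
    unfolding g_def by (intro landau_theta.mult powr_Suc_bigtheta) simp
  have g_pos: "g n > 0" for n
    by (simp add: g_def)
  have "(\<lambda>n. f $ n) \<in> O(g)"
    using f g by (simp add: landau_o.big.cong_bigtheta)
  then obtain c where "eventually (\<lambda>n. norm (f $ n) \<le> c * norm (g n)) sequentially"
    by (elim landau_o.bigE)
  then have "eventually (\<lambda>n. norm (f $ n / g n) \<le> c) sequentially"
    by eventually_elim (use g_pos in \<open>simp add: pos_divide_le_eq order_less_imp_le\<close>)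
  then have "Bseq (\<lambda>n. f $ n / g n)"
    by (rule BfunI)
  then obtain K where K: "K > 0" "\<And>n. norm (f $ n / g n) \<le> K"
    by (elim BseqE) auto
  have fK: "\<bar>f $ n\<bar> \<le> K * g n" for n
    using K(2)[of n] g_pos[of n] by (simp add: pos_divide_le_eq)
  obtain \<rho> where \<rho>: "1 / 4 < \<rho>" "ereal \<rho> < fps_conv_radius q"
    using ereal_dense2[of "ereal (1 / 4)" "fps_conv_radius q"] q by (auto simp: radius_gt_quarter_def)
  then have sum: "summable (\<lambda>k. \<bar>q $ k\<bar> * \<rho> ^ k)"
    using norm_summable_fps[of \<rho> q] by (simp add: abs_mult)
  obtain C where C: "C \<ge> 0" "\<And>k. real (Suc k) powr \<bar>s\<bar> \<le> C * (4 * \<rho>) ^ k"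
    using powr_le_const_mult_power[of "4 * \<rho>" "\<bar>s\<bar>"] \<rho> by auto
  let ?M = "\<Sum>k. \<bar>q $ k\<bar> * \<rho> ^ k"
  have "norm ((f * q) $ n) \<le> K * C * ?M * norm (g n)" for n
  proof -
    have bound: "\<bar>q $ k * f $ (n - k)\<bar> \<le> K * C * g n * (\<bar>q $ k\<bar> * \<rho> ^ k)" if "k \<le> n" for k
    proof -
      have "g (n - k) * 4 ^ k = 4 ^ n * real (Suc (n - k)) powr s"
        using that by (simp add: g_def flip: power_add)
      also have "\<dots> \<le> 4 ^ n * (real (Suc n) powr s * real (Suc k) powr \<bar>s\<bar>)"
        using powr_diff_le[OF that] by simp
      also have "\<dots> \<le> 4 ^ n * (real (Suc n) powr s * (C * (4 * \<rho>) ^ k))"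
        using C(2)[of k] by (intro mult_left_mono) auto
      also have "\<dots> = C * g n * \<rho> ^ k * 4 ^ k"
        by (simp add: g_def power_mult_distrib mult_ac)
      finally have "g (n - k) \<le> C * g n * \<rho> ^ k"
        by simp
      then have "\<bar>f $ (n - k)\<bar> \<le> K * (C * g n * \<rho> ^ k)"
        using fK[of "n - k"] K(1) by (meson mult_left_mono order_less_imp_le order_trans)
      then have "\<bar>q $ k\<bar> * \<bar>f $ (n - k)\<bar> \<le> \<bar>q $ k\<bar> * (K * (C * g n * \<rho> ^ k))"
        by (rule mult_left_mono) simp
      then show ?thesis
        by (simp add: abs_mult mult_ac)
    qed
    have "\<bar>(f * q) $ n\<bar> = \<bar>\<Sum>k=0..n. q $ k * f $ (n - k)\<bar>"
      by (subst mult.commute) (simp add: fps_mult_nth)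
    also have "\<dots> \<le> (\<Sum>k=0..n. K * C * g n * (\<bar>q $ k\<bar> * \<rho> ^ k))"
      by (rule order_trans[OF sum_abs], rule sum_mono) (use bound in auto)
    also have "\<dots> = K * C * g n * (\<Sum>k=0..n. \<bar>q $ k\<bar> * \<rho> ^ k)"
      by (simp add: sum_distrib_left)
    also have "\<dots> \<le> K * C * g n * ?M"
      using K(1) C(1) g_pos[of n] sum_le_suminf[OF sum, of "{0..n}"] \<rho>
      by (intro mult_left_mono) auto
    finally show ?thesis
      using g_pos[of n] by (simp add: mult_ac)
  qed
  then have "(\<lambda>n. (f * q) $ n) \<in> O(g)"
    by (intro bigoI[of _ "K * C * ?M"] always_eventually) blast
  then show ?thesis
    using g by (simp add: landau_o.big.cong_bigtheta)
qed

text \<open>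
  The coefficient of the second term is the sum of \<open>i - 1/2\<close> over \<open>i < d\<close>. Real exponents make the
  statement meaningful for \<open>d = 0\<close> as well.
\<close>

lemma pochhammer_expansion:
  "(\<lambda>n. pochhammer (real n - 1 / 2) d
        - (real n powr real d + real d * (real d - 2) / 2 * real n powr (real d - 1)))
     \<in> O(\<lambda>n. real n powr (real d - 2))"
proof (induction d)
  case 0
  have "eventually (\<lambda>n. pochhammer (real n - 1 / 2) 0
        - (real n powr real 0 + real 0 * (real 0 - 2) / 2 * real n powr (real 0 - 1)) = 0) sequentially"
    using eventually_gt_at_top[of 0] by eventually_elim simp
  then show ?case
    by (rule landau_o.big.in_cong[THEN iffD2]) simp
next
  case (Suc d)
  define k where "k = real d * (real d - 2) / 2"
  define e where "e = (\<lambda>n. pochhammer (real n - 1 / 2) d - (real n powr real d + k * real n powr (real d - 1)))"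
  have e: "e \<in> O(\<lambda>n. real n powr (real d - 2))"
    using Suc by (simp add: e_def k_def)
  have "eventually (\<lambda>n. norm (real n - 1 / 2 + real d) \<le> (real d + 1) * norm (real n)) sequentially"
    using eventually_ge_at_top[of 1]
  proof eventually_elim
    case (elim n)
    then have "real d * 1 \<le> real d * real n"
      by (intro mult_left_mono) auto
    with elim show ?case
      by (simp add: algebra_simps)
  qed
  then have "(\<lambda>n. real n - 1 / 2 + real d) \<in> O(\<lambda>n. real n)"
    by (rule bigoI)
  then have "(\<lambda>n. e n * (real n - 1 / 2 + real d)) \<in> O(\<lambda>n. real n powr (real d - 2) * real n)"
    using e by (intro landau_o.big.mult)
  also have "(\<lambda>n. real n powr (real d - 2) * real n) \<in> O(\<lambda>n. real n powr (real (Suc d) - 2))"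
  proof -
    have "real n powr (real d - 2) * real n = real n powr (real (Suc d) - 2)" for n
      using powr_add[of "real n" "real d - 2" 1] by (cases "n = 0") (simp_all add: add.commute)
    then show ?thesis by simp
  qed
  finally have 1: "(\<lambda>n. e n * (real n - 1 / 2 + real d)) \<in> O(\<lambda>n. real n powr (real (Suc d) - 2))" .
  have 2: "(\<lambda>n. k * (real d - 1 / 2) * real n powr (real d - 1)) \<in> O(\<lambda>n. real n powr (real (Suc d) - 2))"
    by simp
  have "eventually (\<lambda>n. e n * (real n - 1 / 2 + real d) + k * (real d - 1 / 2) * real n powr (real d - 1)
      = pochhammer (real n - 1 / 2) (Suc d)
        - (real n powr real (Suc d) + real (Suc d) * (real (Suc d) - 2) / 2 * real n powr (real (Suc d) - 1)))
      sequentially"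
    using eventually_gt_at_top[of 0]
  proof eventually_elim
    case (elim n)
    define x y where "x = real n powr real d" and "y = real n powr (real d - 1)"
    have 1: "real n powr real (Suc d) = real n * x"
      using elim by (simp add: x_def powr_add)
    have 2: "y * real n = x"
      using elim powr_add[of "real n" "real d - 1" 1] by (simp add: x_def y_def)
    have 3: "real (Suc d) * (real (Suc d) - 2) / 2 = k + real d - 1 / 2"
      by (simp add: k_def field_simps)
    have 4: "real n powr (real (Suc d) - 1) = x"
      by (simp add: x_def)
    have p: "pochhammer (real n - 1 / 2) d = e n + (x + k * y)"
      by (simp add: e_def x_def y_def)
    have "e n * (real n - 1 / 2 + real d)
        = pochhammer (real n - 1 / 2) (Suc d) - (x + k * y) * (real n - 1 / 2 + real d)"
      unfolding pochhammer_Suc p by (simp add: algebra_simps)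
    also have "(x + k * y) * (real n - 1 / 2 + real d)
        = x * real n + (real d - 1 / 2) * x + k * (y * real n) + k * (real d - 1 / 2) * y"
      by (simp add: algebra_simps)
    finally show ?case
      unfolding 1 3 4 unfolding 2 y_def[symmetric] by (simp add: algebra_simps)
  qed
  then show ?case
    using sum_in_bigo(1)[OF 1 2] by (subst (asm) landau_o.big.in_cong) auto
qed

section \<open>Factorial moments\<close>

lemma falling_factorial_binomial: "falling_factorial (real m) d = fact d * real (m choose d)"
  unfolding falling_factorial_def
  by (simp add: binomial_gbinomial gbinomial_mult_fact lessThan_atLeast0)

definition factorial_moment :: "nat \<Rightarrow> nat \<Rightarrow> nat \<Rightarrow> real" where
  "factorial_moment r d n =
     measure_pmf.expectation (random_plane_tree n) (\<lambda>t. falling_factorial (real (cut_size r t)) d)"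

text \<open>
  The coefficient of \<open>w\<^sup>0\<close> counts all trees with \<open>n\<close> nodes.
\<close>

lemma factorial_moment_eq_moment_gf:
  assumes "n \<ge> 1"
  shows "factorial_moment r d n = fact d * moment_gf r $ d $ n / moment_gf r $ 0 $ n"
proof -
  have "factorial_moment r d n
      = (\<Sum>t\<in>plane_trees n. falling_factorial (real (cut_size r t)) d) / real (card (plane_trees n))"
    unfolding factorial_moment_def random_plane_tree_def
    by (rule integral_pmf_of_set) (use plane_trees_nonempty[OF assms] finite_plane_trees in auto)
  then show ?thesis
    by (simp add: moment_gf_nth falling_factorial_binomial cut_size_eq_tall_nodes sum_distrib_left)
qed

lemma disc_root_nth: "disc_root r $ d $ n
    = of_bool (d = 0 \<and> n = 0) - of_bool (d = 1) * low r $ n - 2 * moment_gf r $ d $ n"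
proof -
  have "(2 * moment_gf r) $ d $ n = 2 * moment_gf r $ d $ n"
    unfolding mult_2 by simp
  then show ?thesis
    unfolding disc_root_def fps_sub_nth fps_X_mult_nth by (auto simp: fps_one_nth)
qed

text \<open>
  For positive \<open>n\<close> the coefficient is \<open>-2\<close> times a number of plane trees.
\<close>

lemma Ypow_half_nonzero: "Ypow (1 / 2) $ n \<noteq> 0"
proof (cases "n = 0")
  case False
  have "moment_gf 0 $ 0 $ n = real (card (plane_trees n))"
    by (simp add: moment_gf_nth)
  moreover have "card (plane_trees n) \<noteq> 0"
    using plane_trees_nonempty[of n] finite_plane_trees[of n] False by simp
  ultimately show ?thesis
    using disc_root_nth[of 0 0 n] False by (simp add: disc_root_0)
qed (simp add: lin_pow_nth)

text \<open>
  The term with \<open>low r\<close> appears only for \<open>d = 1\<close>, because \<open>disc_root\<close> contains \<open>w B\<close> in addition to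
  \<open>moment_gf\<close>; it is exponentially small.
\<close>

lemma factorial_moment_eq_reduced:
  assumes "n \<ge> 1" "d \<ge> 1"
  shows "factorial_moment r d n
    = fact d * (Ypow (1 / 2 - real d) * reduced_root r $ d) $ n / Ypow (1 / 2) $ n
      + of_bool (d = 1) * low r $ n / Ypow (1 / 2) $ n"
proof -
  have 0: "moment_gf r $ 0 $ n = - (Ypow (1 / 2) $ n) / 2"
    using disc_root_nth[of r 0 n] assms by (simp add: disc_root_0)
  have d: "moment_gf r $ d $ n
      = - ((Ypow (1 / 2 - real d) * reduced_root r $ d) $ n + of_bool (d = 1) * low r $ n) / 2"
    using disc_root_nth[of r d n] assms unfolding disc_root_eq_reduced by simp
  have "F * (- (a + u * b) / 2) / (- y / 2) = F * a / y + F * u * b / y" if "y \<noteq> 0" for F a u b y :: real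
    using that by (simp add: field_simps)
  from this[OF Ypow_half_nonzero] have "factorial_moment r d n
      = fact d * (Ypow (1 / 2 - real d) * reduced_root r $ d) $ n / Ypow (1 / 2) $ n
        + fact d * of_bool (d = 1) * low r $ n / Ypow (1 / 2) $ n"
    unfolding factorial_moment_eq_moment_gf[OF assms(1)] 0 d .
  then show ?thesis
    by (cases "d = 1") simp_all
qed

definition second_coeff :: "nat \<Rightarrow> nat \<Rightarrow> real" where
  "second_coeff r d = real d / (12 * (real r + 1) ^ d)
     * (real d * real r ^ 2 - 4 * real d * real r - 3 * real r ^ 2 - 6 * real d + 6 * real r + 6)"

lemma lead0_coeff: "fact d * lead0 r $ d / pochhammer (- 1 / 2) d = 1 / (real r + 1) ^ d"
proof -
  have "lead0 r $ d = ((- 1) ^ d * (- (1 / (real r + 1))) ^ d) * pochhammer (- 1 / 2) d / fact d"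
    by (simp add: lead0_def lin_pow_nth gbinomial_pochhammer)
  also have "(- 1) ^ d * (- (1 / (real r + 1))) ^ d = (1 / (real r + 1)) ^ d"
    unfolding power_mult_distrib[symmetric] by simp
  finally show ?thesis
    using pochhammer_minus_half_nonzero[of d] by (simp add: power_one_over field_simps)
qed

lemma inv_sqrt_nth: "lin_pow (- c) (- 1 / 2) $ k = c ^ k * pochhammer (1 / 2) k / fact k"
proof -
  have "lin_pow (- c) (- 1 / 2) $ k = ((- 1) ^ k * (- c) ^ k) * pochhammer (1 / 2) k / fact k"
    by (simp add: lin_pow_nth gbinomial_pochhammer)
  also have "(- 1) ^ k * (- c) ^ k = c ^ k"
    unfolding power_mult_distrib[symmetric] by simp
  finally show ?thesis .
qed

lemma lead1_coeff:
  "fact (Suc e) * lead1 r $ Suc e / pochhammer (- 1 / 2) e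
     = real (Suc e) * (1 / (real r + 1)) ^ e
         * ((low_c1 r + 1 / 2) * (1 - 2 * real e) - (low_c0 r)\<^sup>2 * real e * (real r + 1))"
proof -
  define c where "c = 1 / (real r + 1)"
  define A B where "A = low_c1 r + 1 / 2" and "B = (low_c0 r)\<^sup>2"
  let ?q = "lin_pow (- c) (- 1 / 2)"
  let ?p = "pochhammer (- 1 / 2 :: real)"
  have half: "pochhammer (1 / 2) e = (1 - 2 * real e) * ?p e" for e
    using pochhammer_rec[of "- 1 / 2 :: real" e] pochhammer_Suc[of "- 1 / 2 :: real" e]
    by (simp add: algebra_simps)
  have cr: "c * (real r + 1) = 1"
    by (simp add: c_def)
  have "lead1 r = fps_X * (fps_const A * ?q + fps_X * (fps_const (B / 2) * ?q))"
    by (simp add: lead1_def A_def B_def c_def algebra_simps)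
  then have coeff: "lead1 r $ Suc e = A * ?q $ e + (if e = 0 then 0 else B / 2 * ?q $ (e - 1))"
    by (simp add: fps_X_mult_nth)
  have main: "fact (Suc e) * lead1 r $ Suc e
      = ?p e * (real (Suc e) * c ^ e * (A * (1 - 2 * real e) - B * real e * (real r + 1)))"
  proof (cases e)
    case 0
    then show ?thesis
      unfolding coeff inv_sqrt_nth by simp
  next
    case (Suc k)
    have p: "pochhammer (1 / 2) k = - 2 * ?p e"
      using pochhammer_rec[of "- 1 / 2 :: real" k] Suc by simp
    have 1: "fact (Suc e) * (A * ?q $ e) = real (Suc e) * A * c ^ e * ((1 - 2 * real e) * ?p e)"
      unfolding inv_sqrt_nth half by simp
    have 2: "fact (Suc e) * (B / 2 * ?q $ k) = - (real (Suc e) * B * real e * c ^ k * ?p e)"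
      unfolding inv_sqrt_nth p using Suc by (simp add: field_simps)
    have 3: "c ^ k = c ^ e * (real r + 1)"
      using cr Suc by simp
    have 4: "lead1 r $ Suc e = A * ?q $ e + B / 2 * ?q $ k"
      using coeff Suc by simp
    have "s * A * x * (u * p) + - (s * B * y * (x * z) * p) = p * (s * x * (A * u - B * y * z))"
      for s x u p y z :: real
      by (simp add: algebra_simps)
    then show ?thesis
      unfolding 4 distrib_left[of "fact (Suc e)"] 1 2 3 .
  qed
  show ?thesis
    unfolding main nonzero_mult_div_cancel_left[OF pochhammer_minus_half_nonzero]
    by (simp only: A_def B_def c_def)
qed

lemma second_coeff_eq:
  assumes "d \<ge> 1"
  shows "1 / (real r + 1) ^ d * (real d * (real d - 2) / 2)
    + fact d * lead1 r $ d / pochhammer (- 1 / 2) (d - 1) = second_coeff r d"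
proof -
  obtain e where d: "d = Suc e"
    using assms by (cases d) auto
  define R where "R = real r + 1"
  have R: "R > 0" and r: "real r = R - 1"
    by (simp_all add: R_def)
  have c1: "(low_c1 r + 1 / 2) * R = (3 * R - (R - 1) * (R + 1)) / 6"
    using R by (simp add: low_c1_def r field_simps)
  have c0: "(low_c0 r)\<^sup>2 * R * R = (R - 1)\<^sup>2 / 4"
    using R by (simp add: low_c0_def r power2_eq_square field_simps)
  have "fact d * lead1 r $ d / pochhammer (- 1 / 2) (d - 1)
      = 1 / R ^ d * (real d * ((low_c1 r + 1 / 2) * R * (3 - 2 * real d) - (low_c0 r)\<^sup>2 * R * R * (real d - 1)))"
  proof -
    have e: "real e = real d - 1" and pw: "(1 / R) ^ e = 1 / R ^ d * R"
      using R by (simp_all add: d power_one_over)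
    have "D * (u * R) * (A * (1 - 2 * (D - 1)) - B * (D - 1) * R)
        = u * (D * (A * R * (3 - 2 * D) - B * R * R * (D - 1)))" for D u A B :: real
      by (simp add: algebra_simps)
    then show ?thesis
      unfolding d diff_Suc_1 lead1_coeff unfolding R_def[symmetric] unfolding pw e d[symmetric] .
  qed
  then have "1 / (real r + 1) ^ d * (real d * (real d - 2) / 2) + fact d * lead1 r $ d / pochhammer (- 1 / 2) (d - 1)
      = 1 / R ^ d * (real d * (real d - 2) / 2
          + real d * ((3 * R - (R - 1) * (R + 1)) / 6 * (3 - 2 * real d) - (R - 1)\<^sup>2 / 4 * (real d - 1)))"
    unfolding c1 c0 R_def[symmetric] by (simp add: distrib_left)
  also have "\<dots> = 1 / R ^ d * (real d / 12
      * (real d * (R - 1)\<^sup>2 - 4 * real d * (R - 1) - 3 * (R - 1)\<^sup>2 - 6 * real d + 6 * (R - 1) + 6))"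
    by (rule arg_cong[of _ _ "\<lambda>x. 1 / R ^ d * x"]) (simp add: field_simps power2_eq_square)
  finally show ?thesis
    unfolding second_coeff_def R_def by (simp add: add.commute)
qed

text \<open>
  Dividing by the number of trees, which is of order \<open>4\<^sup>n\<close> times \<open>n\<close> to the power \<open>-3/2\<close>.
\<close>

lemma bigo_div_Ypow_half:
  assumes "f \<in> O(\<lambda>n. 4 ^ n * real n powr s)"
  shows "(\<lambda>n. f n / Ypow (1 / 2) $ n) \<in> O(\<lambda>n. real n powr (s + 3 / 2))"
proof -
  have "(\<lambda>n. f n / Ypow (1 / 2) $ n) \<in> O(\<lambda>n. 4 ^ n * real n powr s / (4 ^ n * real n powr (- 3 / 2)))"
  proof (rule landau_o.big.divide)
    show "eventually (\<lambda>n. Ypow (1 / 2) $ n \<noteq> 0) sequentially"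
      by (simp add: Ypow_half_nonzero)
    show "eventually (\<lambda>n. 4 ^ n * real n powr (- 3 / 2) \<noteq> 0) sequentially"
      using eventually_gt_at_top[of 0] by eventually_elim simp
    show "(\<lambda>n. 4 ^ n * real n powr (- 3 / 2)) \<in> O(\<lambda>n. Ypow (1 / 2) $ n)"
      using Ypow_half_bigomega by (simp add: bigomega_iff_bigo)
  qed (rule assms)
  also have "(\<lambda>n. 4 ^ n * real n powr s / (4 ^ n * real n powr (- 3 / 2))) = (\<lambda>n. real n powr (s + 3 / 2))"
    using powr_diff[of "real n" s "- 3 / 2" for n] by (auto simp: fun_eq_iff)
  finally show ?thesis .
qed

text \<open>
  The parts of \<open>reduced_root\<close> of order 0, 1 and at least 2 in \<open>Y\<close> contribute Pochhammer symbols of degree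
  \<open>d\<close> and \<open>d - 1\<close> and an error of order \<open>n\<close> to the power \<open>d - 2\<close>. The second coefficient collects the
  second term of the first symbol and the leading term of the second one.
\<close>

lemma factorial_moment_asymptotics:
  assumes "d \<ge> 1"
  shows "(\<lambda>n. factorial_moment r d n
            - (1 / (real r + 1) ^ d * real n ^ d + second_coeff r d * real n ^ (d - 1)))
         \<in> O(\<lambda>n. real n powr (real d - 2))"
proof -
  let ?p = "pochhammer (- 1 / 2 :: real)"
  define C where "C = 1 / (real r + 1) ^ d"
  define K where "K = fact d * lead1 r $ d / ?p (d - 1)"
  define P where "P = (\<lambda>d n. pochhammer (real n - 1 / 2) d)"
  obtain Q where Q: "radius_gt_quarter Q" "reduced_root r $ d = lead r $ d + Y * Y * Q"
    using lead_approximates[of r d] by (auto simp: divisible_by_Y2_def algebra_simps)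
  define err where "err = (\<lambda>n. (fact d * (Ypow (5 / 2 - real d) * Q) $ n + of_bool (d = 1) * low r $ n)
                               / Ypow (1 / 2) $ n)"
  have err: "err \<in> O(\<lambda>n. real n powr (real d - 2))"
  proof -
    have "(\<lambda>n. Ypow (5 / 2 - real d) $ n) \<in> O(\<lambda>n. 4 ^ n * real n powr (real d - 7 / 2))"
      using Ypow_bigo[of "5 / 2 - real d"] by simp
    then have 1: "(\<lambda>n. (Ypow (5 / 2 - real d) * Q) $ n) \<in> O(\<lambda>n. 4 ^ n * real n powr (real d - 7 / 2))"
      using Q(1) by (rule mult_radius_gt_quarter_bigo)
    (* low r = 1 * low r, and the coefficients of 1 vanish eventually: any order of growth will do. *)
    have "eventually (\<lambda>n. (1 :: real fps) $ n = 0) sequentially"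
      using eventually_gt_at_top[of 0] by eventually_elim (simp add: fps_one_nth)
    then have "(\<lambda>n. (1 :: real fps) $ n) \<in> O(\<lambda>n. 4 ^ n * real n powr (real d - 7 / 2))"
      by (rule landau_o.big.in_cong[THEN iffD2]) simp
    then have "(\<lambda>n. (1 * low r) $ n) \<in> O(\<lambda>n. 4 ^ n * real n powr (real d - 7 / 2))"
      using radius_gt_quarter_low by (rule mult_radius_gt_quarter_bigo)
    with 1 have "(\<lambda>n. fact d * (Ypow (5 / 2 - real d) * Q) $ n + of_bool (d = 1) * low r $ n)
        \<in> O(\<lambda>n. 4 ^ n * real n powr (real d - 7 / 2))"
      by (intro sum_in_bigo) (cases "d = 1"; simp)+
    from bigo_div_Ypow_half[OF this] show ?thesis
      by (simp add: err_def)
  qed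
  have expand: "factorial_moment r d n = C * P d n + K * P (d - 1) n + err n" if "n \<ge> 1" for n
  proof -
    have Y1: "Ypow (1 / 2 - real d) * Y = Ypow (1 / 2 - real (d - 1))"
      unfolding Ypow_1[symmetric] lin_pow_mult using assms by (simp add: of_nat_diff)
    have Y2: "Ypow (1 / 2 - real (d - 1)) * Y = Ypow (5 / 2 - real d)"
      unfolding Ypow_1[symmetric] lin_pow_mult using assms by (simp add: of_nat_diff)
    have "Ypow (1 / 2 - real d) * reduced_root r $ d
        = Ypow (1 / 2 - real d) * fps_const (lead0 r $ d)
          + Ypow (1 / 2 - real d) * Y * fps_const (lead1 r $ d)
          + Ypow (1 / 2 - real d) * Y * Y * Q"
      unfolding Q(2) lead_nth distrib_left by (simp only: mult.assoc)
    then have "(Ypow (1 / 2 - real d) * reduced_root r $ d) $ n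
        = Ypow (1 / 2) $ n * (P d n / ?p d) * lead0 r $ d
          + Ypow (1 / 2) $ n * (P (d - 1) n / ?p (d - 1)) * lead1 r $ d
          + (Ypow (5 / 2 - real d) * Q) $ n"
      unfolding Y1 Y2 by (simp only: fps_add_nth fps_mult_right_const_nth Ypow_ratio P_def)
    then have "factorial_moment r d n
        = fact d * lead0 r $ d / ?p d * P d n + K * P (d - 1) n + err n"
      unfolding factorial_moment_eq_reduced[OF that assms] err_def K_def
      using Ypow_half_nonzero[of n] by (simp add: field_simps)
    then show ?thesis
      unfolding lead0_coeff C_def .
  qed
  have main: "(\<lambda>n. C * (P d n - (real n powr real d + real d * (real d - 2) / 2 * real n powr (real d - 1))))
      \<in> O(\<lambda>n. real n powr (real d - 2))"
    using pochhammer_expansion[of d] by (simp add: P_def)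
  have second: "(\<lambda>n. K * (P (d - 1) n - real n powr (real d - 1))) \<in> O(\<lambda>n. real n powr (real d - 2))"
  proof -
    define x k where "x = real (d - 1)" and "k = x * (x - 2) / 2"
    have x: "real d - 1 = x" "real d - 2 = x - 1"
      using assms by (simp_all add: x_def of_nat_diff)
    have "(\<lambda>n. P (d - 1) n - (real n powr x + k * real n powr (x - 1))) \<in> O(\<lambda>n. real n powr (x - 2))"
      using pochhammer_expansion[of "d - 1"] by (simp only: P_def x_def k_def)
    also have "(\<lambda>n. real n powr (x - 2)) \<in> O(\<lambda>n. real n powr (x - 1))"
    proof (rule bigoI[of _ 1])
      show "eventually (\<lambda>n. norm (real n powr (x - 2)) \<le> 1 * norm (real n powr (x - 1))) sequentially"
        using eventually_ge_at_top[of 1] by eventually_elim (auto intro!: powr_mono)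
    qed
    finally have "(\<lambda>n. P (d - 1) n - (real n powr x + k * real n powr (x - 1))) \<in> O(\<lambda>n. real n powr (x - 1))" .
    from sum_in_bigo(1)[OF this, of "\<lambda>n. k * real n powr (x - 1)"]
    have "(\<lambda>n. P (d - 1) n - real n powr x) \<in> O(\<lambda>n. real n powr (x - 1))"
      by simp
    then show ?thesis
      unfolding x by simp
  qed
  have total: "(\<lambda>n. C * (P d n - (real n powr real d + real d * (real d - 2) / 2 * real n powr (real d - 1)))
          + K * (P (d - 1) n - real n powr (real d - 1)) + err n) \<in> O(\<lambda>n. real n powr (real d - 2))"
    by (intro sum_in_bigo main second err)
  have "eventually (\<lambda>n. factorial_moment r d n - (C * real n ^ d + second_coeff r d * real n ^ (d - 1))
      = C * (P d n - (real n powr real d + real d * (real d - 2) / 2 * real n powr (real d - 1)))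
          + K * (P (d - 1) n - real n powr (real d - 1)) + err n) sequentially"
    using eventually_ge_at_top[of 1]
  proof eventually_elim
    case (elim n)
    have pw: "real n powr real d = real n ^ d" "real n powr (real d - 1) = real n ^ (d - 1)"
      using elim assms powr_realpow[of "real n" d] powr_realpow[of "real n" "d - 1"]
      by (simp_all add: of_nat_diff)
    have coeff: "second_coeff r d = C * (real d * (real d - 2) / 2) + K"
      using second_coeff_eq[OF assms, of r] by (simp add: C_def K_def)
    show ?case
      unfolding expand[OF elim] pw coeff by (simp add: algebra_simps)
  qed
  from landau_o.big.in_cong[OF this] show ?thesis
    unfolding C_def[symmetric] using total by (rule iffD2)
qed

lemma variance_eq_factorial_moments:
  assumes "n \<ge> 1"
  shows "measure_pmf.variance (random_plane_tree n) (\<lambda>t. real (cut_size r t))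
    = factorial_moment r 2 n + factorial_moment r 1 n - (factorial_moment r 1 n)\<^sup>2"
proof -
  let ?M = "measure_pmf (random_plane_tree n)"
  let ?X = "\<lambda>t. real (cut_size r t)"
  have int: "integrable ?M f" for f :: "plane_tree \<Rightarrow> real"
    unfolding random_plane_tree_def
    by (rule integrable_measure_pmf_finite)
       (simp add: set_pmf_of_set plane_trees_nonempty[OF assms] finite_plane_trees)
  have "factorial_moment r 2 n = (\<integral>t. (?X t)\<^sup>2 - ?X t \<partial>?M)"
    unfolding factorial_moment_def falling_factorial_def
    by (rule arg_cong[of _ _ "integral\<^sup>L ?M"])
       (auto simp: fun_eq_iff numeral_2_eq_2 power2_eq_square algebra_simps)
  also have "\<dots> = (\<integral>t. (?X t)\<^sup>2 \<partial>?M) - (\<integral>t. ?X t \<partial>?M)"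
    by (rule Bochner_Integration.integral_diff[OF int int])
  finally have "factorial_moment r 2 n = (\<integral>t. (?X t)\<^sup>2 \<partial>?M) - (\<integral>t. ?X t \<partial>?M)" .
  moreover have "factorial_moment r 1 n = (\<integral>t. ?X t \<partial>?M)"
    by (simp add: factorial_moment_def falling_factorial_def)
  ultimately show ?thesis
    using measure_pmf.variance_eq[OF int[of ?X] int[of "\<lambda>t. (?X t)\<^sup>2"]] by simp
qed


theorem theorem1:
  fixes r :: nat
  shows
    "(\<lambda>n. measure_pmf.expectation (random_plane_tree n) (\<lambda>t. real (cut_size r t))
         - (real n / (real r + 1) - real r * (real r - 1) / (6 * (real r + 1))))
       \<in> O(\<lambda>n. 1 / real n)
     \<and> (\<lambda>n. measure_pmf.variance (random_plane_tree n) (\<lambda>t. real (cut_size r t))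
         - real r * (real r + 2) / (6 * (real r + 1) ^ 2) * real n)
       \<in> O(\<lambda>n. 1)
     \<and> (\<forall>d::nat. d \<ge> 1 \<longrightarrow>
         (\<lambda>n. measure_pmf.expectation (random_plane_tree n)
                (\<lambda>t. falling_factorial (real (cut_size r t)) d)
            - (1 / (real r + 1) ^ d * real n ^ d
               + real d / (12 * (real r + 1) ^ d)
                 * (real d * real r ^ 2 - 4 * real d * real r - 3 * real r ^ 2
                    - 6 * real d + 6 * real r + 6)
                 * real n ^ (d - 1)))
         \<in> O(\<lambda>n. real n powr (real d - 3 / 2)))"
proof (intro conjI allI impI)
  define R where "R = real r + 1"
  define u where "u = 1 / R"
  define a where "a = real r * (real r - 1) / (6 * R)"
  have R: "R > 0" and r: "real r = R - 1"
    by (simp_all add: R_def)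
  have mean: "factorial_moment r 1 n = measure_pmf.expectation (random_plane_tree n) (\<lambda>t. real (cut_size r t))" for n
    by (simp add: factorial_moment_def falling_factorial_def)
  define e1 where "e1 = (\<lambda>n. factorial_moment r 1 n - (real n / R - a))"
  define e2 where "e2 = (\<lambda>n. factorial_moment r 2 n - (1 / R\<^sup>2 * real n ^ 2 + second_coeff r 2 * real n))"
  have second_coeff_1: "second_coeff r 1 = - a"
    by (simp add: second_coeff_def a_def R_def power2_eq_square field_simps)
  have e1: "e1 \<in> O(\<lambda>n. 1 / real n)"
  proof -
    have "e1 \<in> O(\<lambda>n. real n powr (real 1 - 2))"
      using factorial_moment_asymptotics[of 1 r] unfolding second_coeff_1 by (simp add: e1_def R_def)
    also have "(\<lambda>n. real n powr (real 1 - 2)) = (\<lambda>n. 1 / real n)"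
      by (simp add: powr_minus_divide)
    finally show ?thesis .
  qed
  then show "(\<lambda>n. measure_pmf.expectation (random_plane_tree n) (\<lambda>t. real (cut_size r t))
         - (real n / (real r + 1) - real r * (real r - 1) / (6 * (real r + 1)))) \<in> O(\<lambda>n. 1 / real n)"
    unfolding e1_def mean a_def R_def .
  show "(\<lambda>n. measure_pmf.variance (random_plane_tree n) (\<lambda>t. real (cut_size r t))
         - real r * (real r + 2) / (6 * (real r + 1) ^ 2) * real n) \<in> O(\<lambda>n. 1)"
  proof -
    have "e2 \<in> O(\<lambda>n. real n powr (real 2 - 2))"
      using factorial_moment_asymptotics[of 2 r] by (simp add: e2_def R_def)
    also have "(\<lambda>n. real n powr (real 2 - 2)) \<in> O(\<lambda>n. 1)"
      by (rule bigoI[of _ 1]) simp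
    finally have e2: "e2 \<in> O(\<lambda>n. 1)" .
    have "(\<lambda>n. 1 / real n) \<in> O(\<lambda>n. 1)"
      by (rule bigoI[of _ 1]) (auto intro!: always_eventually simp: divide_le_eq)
    with e1 have e1_const: "e1 \<in> O(\<lambda>n. 1)"
      by (rule landau_o.big_trans)
    have e1_square: "(\<lambda>n. e1 n * e1 n) \<in> O(\<lambda>n. 1)"
      using landau_o.big.mult[OF e1_const e1_const] by simp
    have e1_linear: "(\<lambda>n. 2 * u * (real n * e1 n)) \<in> O(\<lambda>n. 1)"
    proof -
      have "(\<lambda>n. real n * e1 n) \<in> O(\<lambda>n. real n * (1 / real n))"
        using e1 by (intro landau_o.big.mult) auto
      also have "(\<lambda>n. real n * (1 / real n)) \<in> O(\<lambda>n. 1)"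
        by (rule bigoI[of _ 1]) simp
      finally have "(\<lambda>n. real n * e1 n) \<in> O(\<lambda>n. 1)" .
      from landau_o.big.mult[OF bigo_const[of "2 * u"] this] show ?thesis
        by simp
    qed
    have total: "(\<lambda>n. e2 n + (1 + 2 * a) * e1 n - 2 * u * (real n * e1 n) - e1 n * e1 n - (a + a\<^sup>2)) \<in> O(\<lambda>n. 1)"
      using e2 e1_const e1_linear e1_square by (intro sum_in_bigo) auto
    have "eventually (\<lambda>n. measure_pmf.variance (random_plane_tree n) (\<lambda>t. real (cut_size r t))
         - real r * (real r + 2) / (6 * (real r + 1) ^ 2) * real n
       = e2 n + (1 + 2 * a) * e1 n - 2 * u * (real n * e1 n) - e1 n * e1 n - (a + a\<^sup>2)) sequentially"
      using eventually_ge_at_top[of 1]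
    proof eventually_elim
      case (elim n)
      have m1: "factorial_moment r 1 n = real n * u - a + e1 n"
        and m2: "factorial_moment r 2 n = u * u * (real n * real n) + second_coeff r 2 * real n + e2 n"
        by (simp_all add: e1_def e2_def u_def power2_eq_square)
      (* The terms u^2 n^2 of the second factorial moment and of the squared mean cancel. *)
      have coeff: "real r * (real r + 2) / (6 * (real r + 1) ^ 2) = second_coeff r 2 + u + 2 * a * u"
        using R by (simp add: second_coeff_def a_def u_def r power2_eq_square field_simps)
      show ?case
        unfolding variance_eq_factorial_moments[OF elim] m1 m2 coeff
        by (simp add: power2_eq_square algebra_simps)
    qed
    from landau_o.big.in_cong[OF this] show ?thesis
      using total by (rule iffD2)
  qed
next
  fix d :: nat assume d: "d \<ge> 1"
  have "(\<lambda>n. real n powr (real d - 2)) \<in> O(\<lambda>n. real n powr (real d - 3 / 2))"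
  proof (rule bigoI[of _ 1])
    show "eventually (\<lambda>n. norm (real n powr (real d - 2)) \<le> 1 * norm (real n powr (real d - 3 / 2))) sequentially"
      using eventually_ge_at_top[of 1] by eventually_elim (auto intro!: powr_mono)
  qed
  from landau_o.big_trans[OF factorial_moment_asymptotics[OF d, of r] this]
  show "(\<lambda>n. measure_pmf.expectation (random_plane_tree n)
                (\<lambda>t. falling_factorial (real (cut_size r t)) d)
            - (1 / (real r + 1) ^ d * real n ^ d
               + real d / (12 * (real r + 1) ^ d)
                 * (real d * real r ^ 2 - 4 * real d * real r - 3 * real r ^ 2
                    - 6 * real d + 6 * real r + 6)
                 * real n ^ (d - 1)))
         \<in> O(\<lambda>n. real n powr (real d - 3 / 2))"
    unfolding factorial_moment_def second_coeff_def .
qed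

end
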